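(* There exist a sequence $\{F_n\}_{n\ge0}$ of holomorphic automorphisms of $\mathbb{C}^2$, each having an attracting fixed point at the origin, such that the non-autonomous basin of attraction \[ \Omega_{\{F_n\}}=\{z\in\mathbb{C}^2 : F_n\circ\cdots\circ F_0(z)\to0 \text{ as } n\to\infty\} \] is a Short $\mathbb{C}^2$ whose boundary is $C^\infty$-smooth.
   Context: A Short $\mathbb{C}^2$ is a domain $\Omega\subset\mathbb{C}^2$ such that: (1) $\Omega=\bigcup_{j\ge1}\Omega_j$ with $\Omega_j\subset\Omega_{j+1}$ and each $\Omega_j$ biholomorphic to the unit ball of $\mathbb{C}^2$; (2) the infinitesimal Kobayashi pseudometric of $\Omega$ vanishes identically; (3) $\Omega$ carries a non-constant plurisubharmonic function that is bounded above. *)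

theory Defs
  imports "HOL-Analysis.Analysis"
begin

text \<open>We model C^2 as the type complex \<times> complex; its norm is the Euclidean norm
  sqrt(|z1|^2 + |z2|^2), so ball 0 1 is the unit ball of C^2.\<close>

type_synonym C2 = "complex \<times> complex"

definition cmul :: "complex \<Rightarrow> C2 \<Rightarrow> C2" where
  "cmul c z = (c * fst z, c * snd z)"

definition hol2 :: "(C2 \<Rightarrow> C2) \<Rightarrow> C2 set \<Rightarrow> bool" where
  "hol2 F U \<longleftrightarrow> (\<forall>z\<in>U. \<exists>L. (F has_derivative L) (at z) \<and>
       (\<forall>c v. L (cmul c v) = cmul c (L v)))"

definition holomorphic_automorphism :: "(C2 \<Rightarrow> C2) \<Rightarrow> bool" where
  "holomorphic_automorphism F \<longleftrightarrow> bij F \<and> hol2 F UNIV \<and> hol2 (inv F) UNIV"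

definition attracting_fixed_point_at_0 :: "(C2 \<Rightarrow> C2) \<Rightarrow> bool" where
  "attracting_fixed_point_at_0 F \<longleftrightarrow> F 0 = 0 \<and>
     (\<forall>e v. v \<noteq> 0 \<and> frechet_derivative F (at 0) v = cmul e v \<longrightarrow> cmod e < 1)"

primrec comp_seq :: "(nat \<Rightarrow> C2 \<Rightarrow> C2) \<Rightarrow> nat \<Rightarrow> C2 \<Rightarrow> C2" where
  "comp_seq F 0 = F 0"
| "comp_seq F (Suc n) = F (Suc n) \<circ> comp_seq F n"

definition nonautonomous_basin :: "(nat \<Rightarrow> C2 \<Rightarrow> C2) \<Rightarrow> C2 set" where
  "nonautonomous_basin F = {z. (\<lambda>n. comp_seq F n z) \<longlonglongrightarrow> 0}"

definition biholomorphic_to_ball :: "C2 set \<Rightarrow> bool" where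
  "biholomorphic_to_ball W \<longleftrightarrow> open W \<and> (\<exists>\<phi>. hol2 \<phi> (ball 0 1) \<and> inj_on \<phi> (ball 0 1) \<and>
       \<phi> ` ball 0 1 = W \<and> hol2 (inv_into (ball 0 1) \<phi>) W)"

definition hol_disc :: "(complex \<Rightarrow> C2) \<Rightarrow> bool" where
  "hol_disc f \<longleftrightarrow> (\<lambda>\<zeta>. fst (f \<zeta>)) holomorphic_on ball 0 1 \<and> (\<lambda>\<zeta>. snd (f \<zeta>)) holomorphic_on ball 0 1"

definition kobayashi :: "C2 set \<Rightarrow> C2 \<Rightarrow> C2 \<Rightarrow> real" where
  "kobayashi \<Omega> z v = Inf {a::real. a > 0 \<and> (\<exists>f. hol_disc f \<and> f ` ball 0 1 \<subseteq> \<Omega> \<and> f 0 = z \<and>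
       (deriv (\<lambda>\<zeta>. fst (f \<zeta>)) 0, deriv (\<lambda>\<zeta>. snd (f \<zeta>)) 0) = cmul (complex_of_real (1 / a)) v)}"

text \<open>Plurisubharmonic functions with values in [-\<infinity>, \<infinity>): upper semicontinuous, and
  sub-mean value property on every closed complex disc a + \<zeta> b, |\<zeta>| \<le> 1, in \<Omega>:
  u(a) \<le> (1/2\<pi>) \<integral>_0^{2\<pi>} u(a + e^{i\<theta>} b) d\<theta>.  Since u may take the value -\<infinity>, the mean
  is expressed through the nonnegative integral of M - u for any real upper bound M.\<close>
definition usc_on :: "C2 set \<Rightarrow> (C2 \<Rightarrow> ereal) \<Rightarrow> bool" where
  "usc_on \<Omega> u \<longleftrightarrow> (\<forall>z\<in>\<Omega>. \<forall>c. u z < c \<longrightarrow> (\<forall>\<^sub>F w in at z. u w < c))"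

definition circle_sub_mean :: "(C2 \<Rightarrow> ereal) \<Rightarrow> C2 \<Rightarrow> C2 \<Rightarrow> bool" where
  "circle_sub_mean u a b \<longleftrightarrow> (\<forall>M::real. (\<forall>\<theta>. u (a + cmul (cis \<theta>) b) \<le> ereal M) \<longrightarrow>
      u a \<le> ereal M - enn2ereal ((\<integral>\<^sup>+ \<theta>\<in>{0..2*pi}. e2ennreal (ereal M - u (a + cmul (cis \<theta>) b)) \<partial>lborel)
                                   / ennreal (2*pi)))"

definition plurisubharmonic :: "(C2 \<Rightarrow> ereal) \<Rightarrow> C2 set \<Rightarrow> bool" where
  "plurisubharmonic u \<Omega> \<longleftrightarrow> (\<forall>z\<in>\<Omega>. u z \<noteq> \<infinity>) \<and> usc_on \<Omega> u \<and>
     (\<forall>a b. {a + cmul \<zeta> b | \<zeta>. cmod \<zeta> \<le> 1} \<subseteq> \<Omega> \<longrightarrow> circle_sub_mean u a b)"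

definition short_C2 :: "C2 set \<Rightarrow> bool" where
  "short_C2 \<Omega> \<longleftrightarrow> open \<Omega> \<and> connected \<Omega> \<and>
     (\<exists>W::nat \<Rightarrow> C2 set. (\<forall>j. W j \<subseteq> W (Suc j)) \<and> \<Omega> = (\<Union>j. W j) \<and> (\<forall>j. biholomorphic_to_ball (W j))) \<and>
     (\<forall>z\<in>\<Omega>. \<forall>v. kobayashi \<Omega> z v = 0) \<and>
     (\<exists>u. plurisubharmonic u \<Omega> \<and> (\<exists>M::real. \<forall>z\<in>\<Omega>. u z \<le> ereal M) \<and> (\<exists>z\<in>\<Omega>. \<exists>w\<in>\<Omega>. u z \<noteq> u w))"

fun Ck_on :: "nat \<Rightarrow> (C2 \<Rightarrow> real) \<Rightarrow> C2 set \<Rightarrow> bool" where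
  "Ck_on 0 f U = continuous_on U f"
| "Ck_on (Suc k) f U = ((\<forall>z\<in>U. f differentiable (at z)) \<and>
      (\<forall>v. Ck_on k (\<lambda>z. frechet_derivative f (at z) v) U))"

definition smooth_boundary :: "C2 set \<Rightarrow> bool" where
  "smooth_boundary \<Omega> \<longleftrightarrow> (\<forall>p\<in>frontier \<Omega>. \<exists>U \<rho>. open U \<and> p \<in> U \<and> (\<forall>k. Ck_on k \<rho> U) \<and>
      \<Omega> \<inter> U = {z\<in>U. \<rho> z < 0} \<and> (\<forall>z\<in>U. frechet_derivative \<rho> (at z) \<noteq> (\<lambda>_. 0)))"

end

theory Submission
  imports Defs "HOL-Complex_Analysis.Complex_Analysis"
begin

text \<open>
  Take the Henon maps \<open>F n (z, w) = (z\<^sup>2 + a n * w, z)\<close> with \<open>0 < cmod (a n) \<le> 1/16\<close>. The first coordinates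
  of the compositions are polynomials \<open>P n\<close> with \<open>P (n + 2) = (P (n + 1))\<^sup>2 + a n * P n\<close>. For all such
  coefficients the basin is an increasing union of preimages of the ball under automorphisms of \<open>\<complex>\<^sup>2\<close>, and
  pulling back affine discs shows that its Kobayashi metric vanishes, since the derivatives of the
  compositions tend to \<open>0\<close> on the basin.

  If the \<open>a n\<close> decrease fast enough, then \<open>P (n + 1)\<close> is nearly \<open>(P n)\<^sup>2\<close> on the ball of radius \<open>n\<close>, so
  that \<open>ln (cmod (P n) + (1/8) ^ 2 ^ n) / 2 ^ n\<close> converges locally uniformly to a continuous
  plurisubharmonic function \<open>green\<close>, which is not constant on the basin \<open>{q. green q < 0}\<close>. Near a boundary
  point the functions \<open>ln (cmod (P n)) / 2 ^ n\<close> are real parts of holomorphic functions and converge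
  uniformly to \<open>green\<close>, which is therefore pluriharmonic there; it is submersive because each \<open>a n\<close> is chosen
  after \<open>P n\<close> and \<open>P (n + 1)\<close> so small that the logarithmic derivative of \<open>P (n + 2)\<close> is almost twice that
  of \<open>P (n + 1)\<close>.
\<close>

subsection \<open>Convergence and compactness\<close>

lemma uniform_limit_lim_if_summable_steps:
  fixes f :: "nat \<Rightarrow> 'a \<Rightarrow> 'b::banach"
  assumes "\<forall>\<^sub>F n in sequentially. \<forall>x\<in>S. norm (f (Suc n) x - f n x) \<le> M n" and "summable M"
  shows "uniform_limit S f (\<lambda>x. lim (\<lambda>n. f n x)) sequentially"
proof -
  have "uniform_limit S (\<lambda>n x. f 0 x + (\<Sum>i<n. f (Suc i) x - f i x))
      (\<lambda>x. f 0 x + (\<Sum>i. f (Suc i) x - f i x)) sequentially"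
    by (intro uniform_limit_add uniform_limit_const Weierstrass_m_test_ev[OF assms])
  moreover have "(\<Sum>i<n. f (Suc i) x - f i x) = f n x - f 0 x" for n x by (rule sum_lessThan_telescope)
  ultimately have lim: "uniform_limit S f (\<lambda>x. f 0 x + (\<Sum>i. f (Suc i) x - f i x)) sequentially" by simp
  have "lim (\<lambda>n. f n x) = f 0 x + (\<Sum>i. f (Suc i) x - f i x)" if "x \<in> S" for x
    by (rule limI[OF tendsto_uniform_limitI[OF lim that]])
  then show ?thesis using lim by (subst uniform_limit_cong'[OF refl]) auto
qed

lemma linear_recurrence_tendsto_0:
  fixes d :: "nat \<Rightarrow> 'a::real_normed_vector"
  assumes rec: "\<forall>\<^sub>F n in sequentially. norm (d (Suc (Suc n))) \<le> \<alpha> * norm (d (Suc n)) + \<beta> * norm (d n)"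
    and "\<beta> \<ge> 0" "\<alpha> + \<beta> < 1"
  shows "d \<longlonglongrightarrow> 0"
proof -
  obtain N where N: "\<And>n. n \<ge> N \<Longrightarrow> norm (d (Suc (Suc n))) \<le> \<alpha> * norm (d (Suc n)) + \<beta> * norm (d n)"
    using rec unfolding eventually_sequentially by blast
  define E where "E n = norm (d (Suc (N + n))) + \<beta> * norm (d (N + n))" for n
  have drop: "(1 - \<alpha> - \<beta>) * norm (d (Suc (N + n))) \<le> E n - E (Suc n)" for n
    using N[of "N + n"] by (simp add: E_def algebra_simps)
  moreover have "0 \<le> (1 - \<alpha> - \<beta>) * norm (d (Suc (N + n)))" for n using assms(3) by simp
  ultimately have "decseq E" by (intro decseq_SucI) (meson diff_ge_0_iff_ge order_trans)
  moreover have "0 \<le> E n" for n using \<open>\<beta> \<ge> 0\<close> by (simp add: E_def)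
  ultimately obtain L where L: "E \<longlonglongrightarrow> L" using decseq_convergent by metis
  have "(\<lambda>n. (E n - E (Suc n)) / (1 - \<alpha> - \<beta>)) \<longlonglongrightarrow> (L - L) / (1 - \<alpha> - \<beta>)"
    using assms(3) by (intro tendsto_intros LIMSEQ_Suc L) simp
  then have "(\<lambda>n. (E n - E (Suc n)) / (1 - \<alpha> - \<beta>)) \<longlonglongrightarrow> 0" by simp
  then have "(\<lambda>n. d (Suc (N + n))) \<longlonglongrightarrow> 0"
    by (rule Lim_null_comparison[rotated])
      (use drop assms(3) in \<open>auto intro!: always_eventually simp: pos_le_divide_eq mult.commute\<close>)
  then have "(\<lambda>n. d (n + Suc N)) \<longlonglongrightarrow> 0" by (simp add: add.commute)
  then show ?thesis by (rule LIMSEQ_offset)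
qed

lemma eventually_less_on_compact:
  fixes u v :: "'a::topological_space \<times> 'b::topological_space \<Rightarrow> real"
  assumes "compact K" and cont: "continuous_on UNIV u" "continuous_on UNIV v"
    and less: "\<And>y. y \<in> K \<Longrightarrow> u (x0, y) < v (x0, y)"
  shows "\<forall>\<^sub>F x in nhds x0. \<forall>y\<in>K. u (x, y) < v (x, y)"
proof -
  have subset: "{x0} \<times> K \<subseteq> {p. u p < v p}" using less by auto
  obtain X where X: "x0 \<in> X" "open X" "X \<times> K \<subseteq> {p. u p < v p}"
    using Elementary_Topology.tube_lemma[OF \<open>compact K\<close> open_Collect_less[OF cont] subset] by (elim exE conjE)
  have "\<forall>y\<in>K. u (x, y) < v (x, y)" if "x \<in> X" for x using X(3) that by auto
  then show ?thesis using X(1,2) unfolding eventually_nhds by blast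
qed

subsection \<open>Complex lines and linear forms in the plane\<close>

lemma norm_cmul: "norm (cmul c v) = cmod c * norm v"
proof -
  have "(norm (cmul c v))\<^sup>2 = (cmod c * norm v)\<^sup>2"
    by (simp add: cmul_def norm_prod_def norm_mult power_mult_distrib algebra_simps)
  then show ?thesis by (simp add: power2_eq_iff_nonneg)
qed

lemma cmul_0_left [simp]: "cmul 0 v = 0"
  by (simp add: cmul_def zero_prod_def)

lemma cmul_add_left: "cmul (a + b) v = cmul a v + cmul b v"
  by (simp add: cmul_def algebra_simps)

lemma continuous_on_cmul [continuous_intros]:
  "continuous_on S f \<Longrightarrow> continuous_on S g \<Longrightarrow> continuous_on S (\<lambda>x. cmul (f x) (g x))"
  unfolding cmul_def by (intro continuous_intros)

definition cdot :: "C2 \<Rightarrow> C2 \<Rightarrow> complex" where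
  "cdot p v = fst p * fst v + snd p * snd v"

lemma cdot_cmul_left: "cdot (cmul c p) v = c * cdot p v"
  by (simp add: cdot_def cmul_def algebra_simps)

lemma cdot_cmul_right: "cdot p (cmul c v) = c * cdot p v"
  by (simp add: cdot_def cmul_def algebra_simps)

lemma cdot_add_left: "cdot (p + q) v = cdot p v + cdot q v"
  by (simp add: cdot_def algebra_simps)

lemma cdot_cnj: "cdot p (cnj (fst p), cnj (snd p)) = of_real ((norm p)\<^sup>2)"
  by (simp add: cdot_def norm_prod_def complex_norm_square[symmetric] del: of_real_power)

lemma has_field_derivative_along_line:
  assumes "(f has_derivative L) (at (q + cmul \<zeta> v))" and "\<And>c. L (cmul c v) = c * L v"
  shows "((\<lambda>\<zeta>. f (q + cmul \<zeta> v)) has_field_derivative L v) (at \<zeta>)"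
proof -
  have "((\<lambda>\<zeta>. q + cmul \<zeta> v) has_derivative (\<lambda>h. cmul h v)) (at \<zeta>)"
    unfolding cmul_def by (auto intro!: derivative_eq_intros simp: zero_prod_def)
  from diff_chain_at[OF this assms(1)] show ?thesis
    by (simp add: has_field_derivative_def o_def assms(2) mult.commute[of _ "L v"])
qed

subsection \<open>Automorphisms of the plane and the Kobayashi metric\<close>

lemma hol2_subset: "hol2 F U \<Longrightarrow> V \<subseteq> U \<Longrightarrow> hol2 F V"
  unfolding hol2_def by blast

lemma hol2_compose:
  assumes "hol2 F V" "hol2 G U" "G ` U \<subseteq> V"
  shows "hol2 (F \<circ> G) U"
  unfolding hol2_def
proof
  fix z assume z: "z \<in> U"
  obtain L where L: "(G has_derivative L) (at z)" "\<And>c v. L (cmul c v) = cmul c (L v)"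
    using assms(2) z unfolding hol2_def by blast
  obtain K where K: "(F has_derivative K) (at (G z))" "\<And>c v. K (cmul c v) = cmul c (K v)"
    using assms(1,3) z unfolding hol2_def by blast
  show "\<exists>L. (F \<circ> G has_derivative L) (at z) \<and> (\<forall>c v. L (cmul c v) = cmul c (L v))"
    using diff_chain_at[OF L(1) K(1)] L(2) K(2) by (intro exI[of _ "K \<circ> L"]) auto
qed

lemma hol2_transform:
  assumes "hol2 F U" "open U" "\<And>z. z \<in> U \<Longrightarrow> F z = G z"
  shows "hol2 G U"
  unfolding hol2_def
proof
  fix z assume z: "z \<in> U"
  then obtain L where L: "(F has_derivative L) (at z)" "\<forall>c v. L (cmul c v) = cmul c (L v)"
    using assms(1) unfolding hol2_def by blast
  then show "\<exists>L. (G has_derivative L) (at z) \<and> (\<forall>c v. L (cmul c v) = cmul c (L v))"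
    using has_derivative_transform_within_open[OF L(1) assms(2) z assms(3)] by blast
qed

lemma hol2_imp_continuous_on: "hol2 F U \<Longrightarrow> continuous_on U F"
  unfolding hol2_def by (meson continuous_at_imp_continuous_on has_derivative_continuous)

lemma holomorphic_automorphismI:
  assumes "hol2 F UNIV" "hol2 G UNIV" and FG: "\<And>z. F (G z) = z" and GF: "\<And>z. G (F z) = z"
  shows "holomorphic_automorphism F"
proof -
  have "bij F" using FG GF by (metis bijI')
  moreover have "inv F = G" using FG GF by (intro inv_equality) auto
  ultimately show ?thesis using assms(1,2) by (simp add: holomorphic_automorphism_def)
qed

lemma holomorphic_automorphism_compose:
  assumes "holomorphic_automorphism F" "holomorphic_automorphism G"
  shows "holomorphic_automorphism (F \<circ> G)"
  using assms unfolding holomorphic_automorphism_def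
  by (auto simp: bij_comp o_inv_distrib intro: hol2_compose)

lemma hol2_diagonal: "hol2 (\<lambda>q. (a * fst q, b * snd q)) U"
proof -
  have "((\<lambda>q. (a * fst q, b * snd q)) has_derivative (\<lambda>v. (a * fst v, b * snd v))) (at z)" for z
    by (auto intro!: derivative_eq_intros)
  moreover have "(a * fst (cmul c v), b * snd (cmul c v)) = cmul c (a * fst v, b * snd v)" for c v
    by (simp add: cmul_def)
  ultimately show ?thesis unfolding hol2_def by blast
qed

lemma holomorphic_automorphism_diagonal:
  assumes "a \<noteq> 0" "b \<noteq> 0"
  shows "holomorphic_automorphism (\<lambda>q. (a * fst q, b * snd q))"
  by (rule holomorphic_automorphismI[OF hol2_diagonal hol2_diagonal[of "inverse a" "inverse b"]])
    (use assms in \<open>auto simp: mult.assoc[symmetric]\<close>)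

lemma connected_vimage_ball_automorphism:
  assumes "holomorphic_automorphism H"
  shows "connected (H -` ball 0 1)"
proof -
  have "continuous_on (ball 0 1) (inv H)"
    using assms unfolding holomorphic_automorphism_def
    by (meson continuous_on_subset hol2_imp_continuous_on subset_UNIV)
  then have "connected (inv H ` ball 0 1)" by (intro connected_continuous_image connected_ball)
  then show ?thesis
    using assms by (simp add: holomorphic_automorphism_def bij_vimage_eq_inv_image)
qed

lemma biholomorphic_to_ball_vimage:
  assumes "holomorphic_automorphism H"
  shows "biholomorphic_to_ball (H -` ball 0 1)"
proof -
  have bij: "bij H" and hol: "hol2 H UNIV" "hol2 (inv H) UNIV"
    using assms by (auto simp: holomorphic_automorphism_def)
  have open_preimage: "open (H -` ball 0 1)"
    using hol2_imp_continuous_on[OF hol(1)] by (intro open_vimage) auto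
  have inj: "inj_on (inv H) (ball 0 1)"
    using bij by (meson bij_betw_def bij_betw_inv_into inj_on_subset subset_UNIV)
  have "hol2 (inv_into (ball 0 1) (inv H)) (H -` ball 0 1)"
  proof (rule hol2_transform[OF hol2_subset[OF hol(1) subset_UNIV] open_preimage])
    show "H q = inv_into (ball 0 1) (inv H) q" if "q \<in> H -` ball 0 1" for q
      using inv_into_f_f[OF inj, of "H q"] that bij by (simp add: bij_is_inj)
  qed
  then show ?thesis
    unfolding biholomorphic_to_ball_def bij_vimage_eq_inv_image[OF bij]
    using open_preimage inj hol2_subset[OF hol(2)] by (auto simp: bij_vimage_eq_inv_image[OF bij])
qed

lemma hol_disc_line:
  assumes "hol2 G UNIV"
  shows "hol_disc (\<lambda>\<zeta>. G (q + cmul \<zeta> w))"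
    and "(G has_derivative K) (at q) \<Longrightarrow>
      (deriv (\<lambda>\<zeta>. fst (G (q + cmul \<zeta> w))) 0, deriv (\<lambda>\<zeta>. snd (G (q + cmul \<zeta> w))) 0) = K w"
proof -
  have deriv: "((\<lambda>\<zeta>. fst (G (q + cmul \<zeta> w))) has_field_derivative fst (K w)) (at \<zeta>) \<and>
      ((\<lambda>\<zeta>. snd (G (q + cmul \<zeta> w))) has_field_derivative snd (K w)) (at \<zeta>)"
    if K: "(G has_derivative K) (at (q + cmul \<zeta> w))" for K \<zeta>
  proof -
    have linear: "K (cmul c v) = cmul c (K v)" for c v
      using assms K has_derivative_unique unfolding hol2_def by blast
    show ?thesis
      by (intro conjI has_field_derivative_along_line has_derivative_fst has_derivative_snd K)
        (simp_all add: linear, simp_all add: cmul_def)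
  qed
  show "hol_disc (\<lambda>\<zeta>. G (q + cmul \<zeta> w))"
    unfolding hol_disc_def holomorphic_on_def
    using deriv assms unfolding hol2_def
    by (meson UNIV_I field_differentiable_at_within field_differentiable_def)
  show "(deriv (\<lambda>\<zeta>. fst (G (q + cmul \<zeta> w))) 0, deriv (\<lambda>\<zeta>. snd (G (q + cmul \<zeta> w))) 0) = K w"
    if "(G has_derivative K) (at q)"
    using deriv[of K 0] that by (auto dest!: DERIV_imp_deriv simp: prod_eq_iff)
qed

lemma hol_disc_pullback_automorphism:
  assumes H: "holomorphic_automorphism H" and L: "(H has_derivative L) (at z)"
    and small: "norm (H z) + cmod c * norm (L v) < 1"
  obtains f where "hol_disc f" "f 0 = z" "f ` ball 0 1 \<subseteq> H -` ball 0 1"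
    "(deriv (\<lambda>\<zeta>. fst (f \<zeta>)) 0, deriv (\<lambda>\<zeta>. snd (f \<zeta>)) 0) = cmul c v"
proof -
  have bij: "bij H" and inv: "hol2 (inv H) UNIV"
    using H by (auto simp: holomorphic_automorphism_def)
  define f where "f = (\<lambda>\<zeta>. inv H (H z + cmul \<zeta> (cmul c (L v))))"
  obtain K where K: "(inv H has_derivative K) (at (H z))" "\<And>c v. K (cmul c v) = cmul c (K v)"
    using inv unfolding hol2_def by blast
  have "inv H \<circ> H = id" using bij by (simp add: bij_is_inj)
  then have "K \<circ> L = id"
    using diff_chain_at[OF L K(1)] has_derivative_id has_derivative_unique by metis
  then have "K (cmul c (L v)) = cmul c v" by (metis K(2) comp_apply id_apply)
  then have "(deriv (\<lambda>\<zeta>. fst (f \<zeta>)) 0, deriv (\<lambda>\<zeta>. snd (f \<zeta>)) 0) = cmul c v"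
    using hol_disc_line(2)[OF inv K(1)] by (simp add: f_def)
  moreover have "f ` ball 0 1 \<subseteq> H -` ball 0 1"
  proof (rule image_subsetI)
    fix \<zeta> :: complex assume "\<zeta> \<in> ball 0 1"
    then have "norm (cmul \<zeta> (cmul c (L v))) \<le> cmod c * norm (L v)"
      by (simp add: norm_cmul mult_left_le_one_le)
    then have "norm (H z + cmul \<zeta> (cmul c (L v))) < 1"
      using norm_triangle_ineq[of "H z" "cmul \<zeta> (cmul c (L v))"] small by linarith
    then show "f \<zeta> \<in> H -` ball 0 1" using bij by (simp add: f_def bij_is_surj surj_f_inv_f)
  qed
  moreover have "f 0 = z" using bij by (simp add: f_def bij_is_inj)
  moreover have "hol_disc f" unfolding f_def by (rule hol_disc_line(1)[OF inv])
  ultimately show ?thesis using that by blast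
qed

lemma kobayashi_eq_0I:
  assumes "\<And>r. r > 0 \<Longrightarrow> \<exists>H L. holomorphic_automorphism H \<and> H -` ball 0 1 \<subseteq> \<Omega> \<and>
      (H has_derivative L) (at z) \<and> norm (H z) < 1/2 \<and> norm (L v) < r"
  shows "kobayashi \<Omega> z v = 0"
proof -
  have "\<exists>f. hol_disc f \<and> f ` ball 0 1 \<subseteq> \<Omega> \<and> f 0 = z \<and>
      (deriv (\<lambda>\<zeta>. fst (f \<zeta>)) 0, deriv (\<lambda>\<zeta>. snd (f \<zeta>)) 0) = cmul (complex_of_real (1 / a)) v"
    if a: "a > 0" for a :: real
  proof -
    obtain H L where H: "holomorphic_automorphism H" "H -` ball 0 1 \<subseteq> \<Omega>"
      "(H has_derivative L) (at z)" "norm (H z) < 1/2" "norm (L v) < a/2"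
      using assms[of "a/2"] a by auto
    have "norm (L v) / a < 1/2" using H(5) a by (simp add: field_simps)
    then have "norm (H z) + norm (L v) / a < 1" using H(4) by linarith
    then have "norm (H z) + cmod (of_real (1/a)) * norm (L v) < 1"
      using a by (simp add: norm_divide)
    from hol_disc_pullback_automorphism[OF H(1,3) this] show ?thesis using H(2) by (metis subset_trans)
  qed
  then have "{a. a > 0 \<and> (\<exists>f. hol_disc f \<and> f ` ball 0 1 \<subseteq> \<Omega> \<and> f 0 = z \<and>
      (deriv (\<lambda>\<zeta>. fst (f \<zeta>)) 0, deriv (\<lambda>\<zeta>. snd (f \<zeta>)) 0) = cmul (complex_of_real (1 / a)) v)} = {0<..}"
    by auto
  then show ?thesis unfolding kobayashi_def by simp
qed

subsection \<open>Sub-mean values of logarithms\<close>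

lemma exists_circle_point_norm_ge:
  fixes K :: "complex \<Rightarrow> complex"
  assumes "K holomorphic_on ball 0 1" "continuous_on (cball 0 1) K"
  obtains t where "t \<in> {0..2*pi}" "cmod (K 0) \<le> cmod (K (cis t))"
proof -
  have "continuous_on (sphere 0 1) (\<lambda>z. cmod (K z))"
    using assms(2) by (auto intro: continuous_on_norm continuous_on_subset)
  then obtain w where w_maximal: "w \<in> sphere 0 1" "\<And>z. z \<in> sphere 0 1 \<Longrightarrow> cmod (K z) \<le> cmod (K w)"
    using continuous_attains_sup[OF compact_sphere, of 0 1] by (metis sphere_eq_empty not_one_less_zero)
  have "cmod (K 0) \<le> cmod (K w)"
    by (rule maximum_modulus_frontier[of K "cball 0 1"]) (use assms w_maximal(2) in \<open>auto simp: sphere_def\<close>)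
  moreover have "w = cis (Arg2pi w)"
    using w_maximal(1) complex_norm_eq_1_exp[of w] by (simp add: cis_conv_exp)
  moreover have "Arg2pi w \<in> {0..2*pi}" using Arg2pi by (auto intro: less_imp_le)
  ultimately show ?thesis using that by metis
qed

text \<open>The maximum principle for the product of \<open>g (\<zeta> * \<omega>) + \<eta> * e\<close> over the \<open>N\<close>-th roots of unity \<open>\<omega>\<close>,
  the unimodular \<open>e\<close> being aligned with \<open>g 0\<close>. As \<open>N\<close> grows, the logarithm of the right-hand side becomes
  a Riemann sum for the logarithmic mean, so the sub-mean property follows without Jensen's formula.\<close>

lemma norm_plus_power_le_prod_rotations:
  fixes g :: "complex \<Rightarrow> complex"
  assumes g: "g holomorphic_on ball 0 1" "continuous_on (cball 0 1) g" and "\<eta> \<ge> 0"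
  obtains t where "t \<in> {0..2*pi}"
    "(cmod (g 0) + \<eta>) ^ N \<le> (\<Prod>k<N. cmod (g (cis (t + 2*pi / real N * real k))) + \<eta>)"
proof -
  define e where "e = (if g 0 = 0 then 1 else sgn (g 0))"
  have norm_e: "cmod e = 1" by (simp add: e_def norm_sgn)
  have "g 0 + of_real \<eta> * e = of_real (cmod (g 0) + \<eta>) * e"
    by (simp add: e_def algebra_simps sgn_eq)
  then have aligned: "cmod (g 0 + of_real \<eta> * e) = cmod (g 0) + \<eta>"
    using norm_e assms(3) by (simp add: norm_mult del: of_real_add)
  define \<omega> where "\<omega> k = cis (2*pi / real N * real k)" for k
  define K where "K \<zeta> = (\<Prod>k<N. g (\<zeta> * \<omega> k) + of_real \<eta> * e)" for \<zeta>
  have "(g \<circ> (\<lambda>\<zeta>. \<zeta> * \<omega> k)) holomorphic_on ball 0 1" for k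
    by (rule holomorphic_on_compose_gen[OF _ g(1)]) (auto simp: \<omega>_def norm_mult intro!: holomorphic_intros)
  then have "K holomorphic_on ball 0 1" unfolding K_def o_def by (intro holomorphic_intros)
  moreover have "continuous_on (cball 0 1) (\<lambda>\<zeta>. g (\<zeta> * \<omega> k))" for k
    by (rule continuous_on_compose2[OF g(2)]) (auto simp: \<omega>_def norm_mult intro!: continuous_intros)
  then have "continuous_on (cball 0 1) K" unfolding K_def by (intro continuous_intros)
  ultimately obtain t where t: "t \<in> {0..2*pi}" "cmod (K 0) \<le> cmod (K (cis t))"
    by (rule exists_circle_point_norm_ge)
  have "(cmod (g 0) + \<eta>) ^ N = cmod (K 0)" by (simp add: K_def norm_power aligned)
  also have "\<dots> \<le> cmod (K (cis t))" by (rule t(2))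
  also have "\<dots> \<le> (\<Prod>k<N. cmod (g (cis t * \<omega> k)) + \<eta>)"
    unfolding K_def prod_norm[symmetric]
    using norm_e assms(3) by (intro prod_mono conjI norm_triangle_le) (auto simp: norm_mult)
  finally show ?thesis using that t(1) by (simp add: \<omega>_def cis_mult)
qed

lemma integral_shift_period:
  fixes h :: "real \<Rightarrow> real"
  assumes h: "continuous_on UNIV h" and per: "\<And>x. h (x + p) = h x" and t: "t \<in> {0..p}"
  shows "integral {t..t+p} h = integral {0..p} h"
proof -
  have int: "h integrable_on {a..b}" for a b
    by (intro integrable_continuous_interval continuous_on_subset[OF h]) auto
  have "integral {t..t+p} h = integral {t..p} h + integral {p..t+p} h"
    using t int by (intro Henstock_Kurzweil_Integration.integral_combine[symmetric]) auto
  also have "integral {p..t+p} h = integral {0..t} h"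
  proof -
    have "integral {0..t} (\<lambda>x. h (x + p)) = integral {p..t+p} h"
      using integral_shift_Icc_real[of 0 t h p] by (simp add: o_def add.commute)
    then show ?thesis using per by simp
  qed
  also have "integral {t..p} h + integral {0..t} h = integral {0..p} h"
    using t int Henstock_Kurzweil_Integration.integral_combine[of 0 t p h] by auto
  finally show ?thesis .
qed

lemma riemann_sum_le_integral:
  fixes h :: "real \<Rightarrow> real"
  assumes h: "continuous_on {a..a + d * real N} h" and "d \<ge> 0"
    and osc: "\<And>s t. s \<in> {a..a + d * real N} \<Longrightarrow> t \<in> {a..a + d * real N} \<Longrightarrow> \<bar>s - t\<bar> \<le> d \<Longrightarrow> h s \<le> h t + e"
  shows "d * (\<Sum>k<N. h (a + d * real k)) \<le> integral {a..a + d * real N} h + d * real N * e"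
  using h osc
proof (induction N)
  case (Suc N)
  let ?I = "{a + d * real N..a + d * real (Suc N)}"
  have ends: "a \<le> a + d * real N" "a + d * real N \<le> a + d * real (Suc N)"
    using \<open>d \<ge> 0\<close> by (auto simp: algebra_simps)
  have int: "h integrable_on {a..a + d * real (Suc N)}" "h integrable_on ?I"
    using ends by (auto intro!: integrable_continuous_interval continuous_on_subset[OF Suc.prems(1)])
  have "d * (h (a + d * real N) - e) = integral ?I (\<lambda>_. h (a + d * real N) - e)"
    using ends by (simp add: algebra_simps)
  also have "\<dots> \<le> integral ?I h"
  proof (rule integral_le)
    fix s assume s: "s \<in> ?I"
    then have "a \<le> s" using ends(1) by (meson atLeastAtMost_iff order_trans)
    then show "h (a + d * real N) - e \<le> h s"
      using Suc.prems(2)[of "a + d * real N" s] s ends by (auto simp: distrib_left)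
  qed (use int in auto)
  finally have last: "d * h (a + d * real N) \<le> integral ?I h + d * e" by (simp add: algebra_simps)
  have "d * (\<Sum>k<N. h (a + d * real k)) \<le> integral {a..a + d * real N} h + d * real N * e"
    by (rule Suc.IH) (use Suc.prems ends in \<open>auto intro: continuous_on_subset\<close>)
  moreover have "integral {a..a + d * real N} h + integral ?I h = integral {a..a + d * real (Suc N)} h"
    by (rule Henstock_Kurzweil_Integration.integral_combine[OF ends int(1)])
  ultimately show ?case using last by (simp add: algebra_simps)
qed simp

lemma integral_ge_if_equidistant_means_ge:
  fixes h :: "real \<Rightarrow> real"
  assumes h: "continuous_on UNIV h" and per: "\<And>x. h (x + p) = h x" and "p > 0"
    and means: "\<And>N. N > 0 \<Longrightarrow> \<exists>t\<in>{0..p}. real N * m \<le> (\<Sum>k<N. h (t + p / real N * real k))"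
  shows "p * m \<le> integral {0..p} h"
proof (rule field_le_epsilon)
  fix \<epsilon> :: real assume "\<epsilon> > 0"
  then have "\<epsilon> / p > 0" using \<open>p > 0\<close> by simp
  moreover have "uniformly_continuous_on {0..2*p} h"
    by (intro compact_uniformly_continuous continuous_on_subset[OF h]) auto
  ultimately obtain \<delta> where modulus: "\<delta> > 0"
      "\<And>s t. s \<in> {0..2*p} \<Longrightarrow> t \<in> {0..2*p} \<Longrightarrow> dist t s < \<delta> \<Longrightarrow> dist (h t) (h s) < \<epsilon> / p"
    unfolding uniformly_continuous_on_def by metis
  obtain N :: nat where N: "real N > p / \<delta>" using reals_Archimedean2 by blast
  moreover have "p / \<delta> > 0" using modulus(1) \<open>p > 0\<close> by simp
  ultimately have "N > 0" by (metis less_trans of_nat_0_less_iff)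
  define d where "d = p / real N"
  have mesh: "d > 0" "d < \<delta>" "d * real N = p"
    using N \<open>N > 0\<close> \<open>p > 0\<close> modulus(1) by (auto simp: d_def field_simps)
  obtain t where t: "t \<in> {0..p}" "real N * m \<le> (\<Sum>k<N. h (t + d * real k))"
    using means[OF \<open>N > 0\<close>] unfolding d_def by blast
  have "p * m = d * (real N * m)" using mesh(3) by (metis mult.assoc)
  also have "\<dots> \<le> d * (\<Sum>k<N. h (t + d * real k))" using t(2) mesh(1) by (intro mult_left_mono) auto
  also have "\<dots> \<le> integral {t..t + d * real N} h + d * real N * (\<epsilon> / p)"
  proof (rule riemann_sum_le_integral)
    show "h x \<le> h y + \<epsilon> / p" if "x \<in> {t..t + d * real N}" "y \<in> {t..t + d * real N}" "\<bar>x - y\<bar> \<le> d" for x y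
      using modulus(2)[of y x] that t(1) mesh(2) unfolding mesh(3) by (auto simp: dist_real_def)
  qed (use mesh in \<open>auto intro: continuous_on_subset[OF h]\<close>)
  also have "\<dots> = integral {0..p} h + \<epsilon>"
    unfolding mesh(3) integral_shift_period[OF h per t(1)] using \<open>p > 0\<close> by simp
  finally show "p * m \<le> integral {0..p} h + \<epsilon>" .
qed

lemma sub_mean_ln_norm_plus:
  fixes g :: "complex \<Rightarrow> complex"
  assumes g: "g holomorphic_on ball 0 1" "continuous_on (cball 0 1) g" and \<eta>: "\<eta> > 0"
  shows "2*pi * ln (cmod (g 0) + \<eta>) \<le> integral {0..2*pi} (\<lambda>\<theta>. ln (cmod (g (cis \<theta>)) + \<eta>))"
proof (rule integral_ge_if_equidistant_means_ge)
  have pos: "cmod w + \<eta> > 0" for w using \<eta> by (simp add: add_nonneg_pos)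
  have "continuous_on UNIV (\<lambda>\<theta>. g (cis \<theta>))"
    by (rule continuous_on_compose2[OF g(2)]) (auto intro!: continuous_intros)
  then show "continuous_on UNIV (\<lambda>\<theta>. ln (cmod (g (cis \<theta>)) + \<eta>))"
    using pos by (auto intro!: continuous_intros simp: less_imp_neq[symmetric])
  show "ln (cmod (g (cis (x + 2*pi))) + \<eta>) = ln (cmod (g (cis x)) + \<eta>)" for x
    by (simp add: cis_mult[symmetric])
  fix N :: nat
  define x where "x t k = cmod (g (cis (t + 2*pi / real N * real k))) + \<eta>" for t k
  obtain t where t: "t \<in> {0..2*pi}" "(cmod (g 0) + \<eta>) ^ N \<le> (\<Prod>k<N. x t k)"
    using norm_plus_power_le_prod_rotations[OF g less_imp_le[OF \<eta>]] unfolding x_def by blast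
  have "real N * ln (cmod (g 0) + \<eta>) = ln ((cmod (g 0) + \<eta>) ^ N)" using pos by (simp add: ln_realpow)
  also have "\<dots> \<le> ln (\<Prod>k<N. x t k)"
    using t(2) pos by (intro ln_mono) (auto simp: x_def intro!: prod_pos)
  also have "\<dots> = (\<Sum>k<N. ln (x t k))"
    by (rule ln_prod) (use pos in \<open>auto simp: x_def less_imp_neq[symmetric]\<close>)
  finally show "\<exists>t\<in>{0..2*pi}. real N * ln (cmod (g 0) + \<eta>)
      \<le> (\<Sum>k<N. ln (cmod (g (cis (t + 2*pi / real N * real k))) + \<eta>))"
    using t(1) unfolding x_def by blast
qed simp

subsection \<open>Plurisubharmonic functions\<close>

lemma nn_integral_e2ennreal_diff:
  fixes h :: "real \<Rightarrow> real"
  assumes h: "continuous_on UNIV h" and h_le_M: "\<And>\<theta>. h \<theta> \<le> M" and "a \<le> b"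
  shows "(\<integral>\<^sup>+ \<theta>\<in>{a..b}. e2ennreal (ereal M - ereal (h \<theta>)) \<partial>lborel)
      = ennreal ((b - a) * M - integral {a..b} h)"
    and "0 \<le> (b - a) * M - integral {a..b} h"
proof -
  have "(h has_integral integral {a..b} h) {a..b}"
    by (intro integrable_integral integrable_continuous_interval continuous_on_subset[OF h]) auto
  from has_integral_diff[OF has_integral_const_real[of M a b] this]
  have "((\<lambda>\<theta>. M - h \<theta>) has_integral ((b - a) * M - integral {a..b} h)) {a..b}"
    using \<open>a \<le> b\<close> by simp
  then have "((\<lambda>\<theta>. if \<theta> \<in> {a..b} then M - h \<theta> else 0) has_integral ((b - a) * M - integral {a..b} h)) UNIV"
    by (subst has_integral_restrict_UNIV)
  then have int: "((\<lambda>\<theta>. (M - h \<theta>) * indicator {a..b} \<theta>) has_integral ((b - a) * M - integral {a..b} h)) UNIV"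
    by (rule has_integral_eq[rotated]) (auto simp: indicator_def)
  show "0 \<le> (b - a) * M - integral {a..b} h"
    by (rule has_integral_nonneg[OF int]) (use h_le_M in \<open>auto simp: indicator_def\<close>)
  have [measurable]: "h \<in> borel_measurable borel" using h by (rule borel_measurable_continuous_onI)
  have "(\<integral>\<^sup>+ \<theta>\<in>{a..b}. e2ennreal (ereal M - ereal (h \<theta>)) \<partial>lborel)
      = (\<integral>\<^sup>+ \<theta>. ennreal ((M - h \<theta>) * indicator {a..b} \<theta>) \<partial>lborel)"
    by (intro nn_integral_cong) (auto simp: indicator_def e2ennreal_ereal)
  also have "\<dots> = ennreal ((b - a) * M - integral {a..b} h)"
    by (rule nn_integral_has_integral_lborel[OF _ _ int]) (use h_le_M in \<open>auto simp: indicator_def\<close>)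
  finally show "(\<integral>\<^sup>+ \<theta>\<in>{a..b}. e2ennreal (ereal M - ereal (h \<theta>)) \<partial>lborel)
      = ennreal ((b - a) * M - integral {a..b} h)" .
qed

lemma circle_sub_mean_ereal:
  fixes U :: "C2 \<Rightarrow> real"
  assumes cont: "continuous_on UNIV (\<lambda>\<theta>. U (a + cmul (cis \<theta>) b))"
    and mean: "2*pi * U a \<le> integral {0..2*pi} (\<lambda>\<theta>. U (a + cmul (cis \<theta>) b))"
  shows "circle_sub_mean (\<lambda>z. ereal (U z)) a b"
  unfolding circle_sub_mean_def
proof (intro allI impI)
  fix M :: real
  define h where "h = (\<lambda>\<theta>. U (a + cmul (cis \<theta>) b))"
  define I where "I = 2*pi * M - integral {0..2*pi} h"
  assume "\<forall>\<theta>. ereal (U (a + cmul (cis \<theta>) b)) \<le> ereal M"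
  then have h_le_M: "h \<theta> \<le> M" for \<theta> by (simp add: h_def)
  have integral_eq_I: "(\<integral>\<^sup>+ \<theta>\<in>{0..2*pi}. e2ennreal (ereal M - ereal (h \<theta>)) \<partial>lborel) = ennreal I" "0 \<le> I"
    using nn_integral_e2ennreal_diff[of h M 0 "2*pi"] cont h_le_M by (simp_all add: h_def I_def)
  have "U a \<le> M - I / (2*pi)" using mean by (simp add: I_def h_def field_simps)
  then have "ereal (U a) \<le> ereal M - enn2ereal (ennreal I / ennreal (2*pi))"
    using integral_eq_I(2) by (simp add: divide_ennreal enn2ereal_ennreal)
  then show "ereal (U a) \<le> ereal M - enn2ereal ((\<integral>\<^sup>+ \<theta>\<in>{0..2*pi}.
      e2ennreal (ereal M - ereal (U (a + cmul (cis \<theta>) b))) \<partial>lborel) / ennreal (2*pi))"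
    unfolding integral_eq_I(1)[unfolded h_def] .
qed

lemma plurisubharmonic_ereal:
  fixes U :: "C2 \<Rightarrow> real"
  assumes cont: "continuous_on UNIV U"
    and mean: "\<And>a b. 2*pi * U a \<le> integral {0..2*pi} (\<lambda>\<theta>. U (a + cmul (cis \<theta>) b))"
  shows "plurisubharmonic (\<lambda>z. ereal (U z)) \<Omega>"
proof -
  have "usc_on \<Omega> (\<lambda>z. ereal (U z))"
    unfolding usc_on_def
  proof (intro ballI allI impI)
    fix z c assume "ereal (U z) < c"
    moreover have "((\<lambda>w. ereal (U w)) \<longlongrightarrow> ereal (U z)) (at z)"
      using cont unfolding continuous_on_def by (intro tendsto_intros) blast
    ultimately show "\<forall>\<^sub>F w in at z. ereal (U w) < c" by (rule order_tendstoD(2)[rotated])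
  qed
  moreover have "continuous_on UNIV (\<lambda>\<theta>. U (a + cmul (cis \<theta>) b))" for a b
    by (rule continuous_on_compose2[OF cont]) (auto intro!: continuous_intros)
  then have "circle_sub_mean (\<lambda>z. ereal (U z)) a b" for a b
    using mean by (intro circle_sub_mean_ereal)
  ultimately show ?thesis unfolding plurisubharmonic_def by simp
qed

lemma continuous_on_UNIV_uniform_limit_cball:
  fixes V :: "nat \<Rightarrow> 'a::real_normed_vector \<Rightarrow> 'b::metric_space"
  assumes cont: "\<And>n. continuous_on UNIV (V n)"
    and lim: "\<And>R. uniform_limit (cball 0 R) V U sequentially"
  shows "continuous_on UNIV U"
  unfolding continuous_on_eq_continuous_at[OF open_UNIV]
proof
  fix z :: 'a
  have "continuous_on (cball 0 (norm z + 1)) U"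
    by (rule uniform_limit_theorem[OF _ lim]) (auto intro!: always_eventually continuous_on_subset[OF cont])
  then have "continuous_on (ball 0 (norm z + 1)) U" using continuous_on_subset ball_subset_cball by blast
  then show "isCont U z" by (rule continuous_on_interior) (simp add: interior_open)
qed

lemma plurisubharmonic_uniform_limit:
  fixes U :: "C2 \<Rightarrow> real" and V :: "nat \<Rightarrow> C2 \<Rightarrow> real"
  assumes cont: "\<And>n. continuous_on UNIV (V n)"
    and lim: "\<And>R. uniform_limit (cball 0 R) V U sequentially"
    and mean: "\<And>n a b. 2*pi * V n a \<le> integral {0..2*pi} (\<lambda>\<theta>. V n (a + cmul (cis \<theta>) b))"
  shows "plurisubharmonic (\<lambda>z. ereal (U z)) \<Omega>"
proof (rule plurisubharmonic_ereal)
  show "continuous_on UNIV U" by (rule continuous_on_UNIV_uniform_limit_cball[OF cont lim])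
  fix a b :: C2
  have "a + cmul (cis \<theta>) b \<in> cball 0 (norm a + norm b)" for \<theta>
    using norm_triangle_ineq[of a "cmul (cis \<theta>) b"] by (simp add: norm_cmul)
  then have "uniform_limit {0..2*pi} (\<lambda>n \<theta>. V n (a + cmul (cis \<theta>) b)) (\<lambda>\<theta>. U (a + cmul (cis \<theta>) b)) sequentially"
    by (intro uniform_limit_compose'[OF lim]) blast
  moreover have "continuous_on {0..2*pi} (\<lambda>\<theta>. V n (a + cmul (cis \<theta>) b))" for n
    by (rule continuous_on_compose2[OF cont]) (auto intro!: continuous_intros)
  ultimately obtain I J where integrals: "\<And>n. ((\<lambda>\<theta>. V n (a + cmul (cis \<theta>) b)) has_integral I n) {0..2*pi}"
      "((\<lambda>\<theta>. U (a + cmul (cis \<theta>) b)) has_integral J) {0..2*pi}" "I \<longlonglongrightarrow> J"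
    by (rule uniform_limit_integral) auto
  have "(\<lambda>n. V n a) \<longlonglongrightarrow> U a" by (rule tendsto_uniform_limitI[OF lim[of "norm a"]]) simp
  then have "2*pi * U a \<le> J"
    using mean[of _ a b] unfolding integral_unique[OF integrals(1)]
    by (intro LIMSEQ_le[OF tendsto_mult_left integrals(3)]) auto
  then show "2*pi * U a \<le> integral {0..2*pi} (\<lambda>\<theta>. U (a + cmul (cis \<theta>) b))"
    by (simp add: integral_unique[OF integrals(2)])
qed

subsection \<open>Holomorphic functions of two variables\<close>

text \<open>Holomorphy in Osgood's sense: continuous, and holomorphic along every complex line. Unlike Frechet
  differentiability it passes trivially to uniform limits, and the two notions agree
  (\<open>linewise_holomorphic_on_has_derivative\<close>).\<close>

definition linewise_holomorphic_on :: "(C2 \<Rightarrow> complex) \<Rightarrow> C2 set \<Rightarrow> bool" where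
  "linewise_holomorphic_on f U \<longleftrightarrow> open U \<and> continuous_on U f \<and>
     (\<forall>q\<in>U. \<forall>e. (\<lambda>\<zeta>. f (q + cmul \<zeta> e)) field_differentiable at 0)"

definition dir_deriv :: "C2 \<Rightarrow> (C2 \<Rightarrow> complex) \<Rightarrow> C2 \<Rightarrow> complex" where
  "dir_deriv e f q = deriv (\<lambda>\<zeta>. f (q + cmul \<zeta> e)) 0"

definition cgrad :: "(C2 \<Rightarrow> complex) \<Rightarrow> C2 \<Rightarrow> C2" where
  "cgrad f q = (dir_deriv (1, 0) f q, dir_deriv (0, 1) f q)"

lemma dir_deriv_eqI:
  assumes "(f has_derivative cdot g) (at q)"
  shows "dir_deriv v f q = cdot g v"
  using has_field_derivative_along_line[of f "cdot g" q 0 v] assms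
  by (simp add: dir_deriv_def DERIV_imp_deriv cdot_cmul_right)

lemma cgrad_eqI: "(f has_derivative cdot g) (at q) \<Longrightarrow> cgrad f q = g"
  unfolding cgrad_def by (simp add: dir_deriv_eqI cdot_def)

lemma linewise_holomorphic_on_imp_open: "linewise_holomorphic_on f U \<Longrightarrow> open U"
  by (simp add: linewise_holomorphic_on_def)

lemma linewise_holomorphic_on_imp_continuous_on: "linewise_holomorphic_on f U \<Longrightarrow> continuous_on U f"
  by (simp add: linewise_holomorphic_on_def)

lemma linewise_holomorphic_on_imp_field_differentiable:
  "linewise_holomorphic_on f U \<Longrightarrow> q \<in> U \<Longrightarrow> (\<lambda>\<zeta>. f (q + cmul \<zeta> e)) field_differentiable at 0"
  unfolding linewise_holomorphic_on_def by blast

lemma linewise_holomorphic_on_line_derivative: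
  assumes "linewise_holomorphic_on f U" "q + cmul \<zeta> e \<in> U"
  shows "((\<lambda>\<zeta>. f (q + cmul \<zeta> e)) has_field_derivative dir_deriv e f (q + cmul \<zeta> e)) (at \<zeta>)"
proof -
  have "((\<lambda>x. f ((q + cmul \<zeta> e) + cmul x e)) has_field_derivative dir_deriv e f (q + cmul \<zeta> e)) (at 0)"
    unfolding dir_deriv_def
    by (intro field_differentiable_derivI linewise_holomorphic_on_imp_field_differentiable[OF assms])
  then have "((\<lambda>x. f (q + cmul (x + \<zeta>) e)) has_field_derivative dir_deriv e f (q + cmul \<zeta> e)) (at 0)"
    by (simp add: cmul_add_left ac_simps)
  then show ?thesis using DERIV_shift[of "\<lambda>\<zeta>. f (q + cmul \<zeta> e)" _ 0 \<zeta>] by simp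
qed

lemma linewise_holomorphic_on_line:
  assumes "linewise_holomorphic_on f U" "\<And>\<zeta>. \<zeta> \<in> S \<Longrightarrow> q + cmul \<zeta> e \<in> U"
  shows "(\<lambda>\<zeta>. f (q + cmul \<zeta> e)) holomorphic_on S"
  unfolding holomorphic_on_def field_differentiable_def
  using linewise_holomorphic_on_line_derivative[OF assms(1)] assms(2)
  by (blast intro: has_field_derivative_at_within)

lemma linewise_holomorphic_on_subset:
  "linewise_holomorphic_on f U \<Longrightarrow> open V \<Longrightarrow> V \<subseteq> U \<Longrightarrow> linewise_holomorphic_on f V"
  unfolding linewise_holomorphic_on_def by (blast intro: continuous_on_subset)

lemma linewise_holomorphic_on_local:
  assumes "open U" "\<And>q. q \<in> U \<Longrightarrow> \<exists>V. q \<in> V \<and> linewise_holomorphic_on f V"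
  shows "linewise_holomorphic_on f U"
  unfolding linewise_holomorphic_on_def
proof (intro conjI ballI allI)
  show "continuous_on U f"
    using assms unfolding linewise_holomorphic_on_def
    by (meson continuous_at_imp_continuous_on continuous_on_eq_continuous_at)
  show "(\<lambda>\<zeta>. f (q + cmul \<zeta> e)) field_differentiable at 0" if "q \<in> U" for q e
    using assms(2)[OF that] unfolding linewise_holomorphic_on_def by blast
qed (rule assms(1))

lemma linewise_holomorphic_on_const: "open U \<Longrightarrow> linewise_holomorphic_on (\<lambda>_. c) U"
  by (simp add: linewise_holomorphic_on_def)

lemma linewise_holomorphic_on_fst: "open U \<Longrightarrow> linewise_holomorphic_on fst U"
  and linewise_holomorphic_on_snd: "open U \<Longrightarrow> linewise_holomorphic_on snd U"
  by (auto simp: linewise_holomorphic_on_def cmul_def field_differentiable_def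
      intro!: continuous_intros exI derivative_eq_intros)

lemma linewise_holomorphic_on_add:
  "linewise_holomorphic_on f U \<Longrightarrow> linewise_holomorphic_on g U \<Longrightarrow> linewise_holomorphic_on (\<lambda>q. f q + g q) U"
  by (auto simp: linewise_holomorphic_on_def intro!: continuous_intros field_differentiable_add)

lemma linewise_holomorphic_on_mult:
  "linewise_holomorphic_on f U \<Longrightarrow> linewise_holomorphic_on g U \<Longrightarrow> linewise_holomorphic_on (\<lambda>q. f q * g q) U"
  by (auto simp: linewise_holomorphic_on_def intro!: continuous_intros field_differentiable_mult)

lemma linewise_holomorphic_on_compose:
  assumes f: "linewise_holomorphic_on f U" and g: "g holomorphic_on S" "open S" "f ` U \<subseteq> S"
  shows "linewise_holomorphic_on (\<lambda>q. g (f q)) U"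
  unfolding linewise_holomorphic_on_def
proof (intro conjI ballI allI)
  show "continuous_on U (\<lambda>q. g (f q))"
    using f g by (intro continuous_on_compose2[OF holomorphic_on_imp_continuous_on[OF g(1)]])
      (auto simp: linewise_holomorphic_on_def)
  fix q e assume q: "q \<in> U"
  have "g field_differentiable at (f (q + cmul 0 e))"
    using q g by (auto simp: holomorphic_on_imp_differentiable_at)
  then have "(g \<circ> (\<lambda>\<zeta>. f (q + cmul \<zeta> e))) field_differentiable at 0"
    by (intro field_differentiable_compose linewise_holomorphic_on_imp_field_differentiable[OF f q])
  then show "(\<lambda>\<zeta>. g (f (q + cmul \<zeta> e))) field_differentiable at 0" by (simp add: o_def)
qed (rule linewise_holomorphic_on_imp_open[OF f])

lemma linewise_holomorphic_on_inverse:
  assumes "linewise_holomorphic_on f U" "\<And>q. q \<in> U \<Longrightarrow> f q \<noteq> 0"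
  shows "linewise_holomorphic_on (\<lambda>q. inverse (f q)) U"
  by (rule linewise_holomorphic_on_compose[OF assms(1), of _ "- {0}"])
    (use assms(2) in \<open>auto intro!: holomorphic_on_inverse\<close>)

lemma linewise_holomorphic_on_Ln:
  assumes "linewise_holomorphic_on f U" "\<And>q. q \<in> U \<Longrightarrow> 0 < Re (f q)"
  shows "linewise_holomorphic_on (\<lambda>q. Ln (f q)) U"
proof (rule linewise_holomorphic_on_compose[OF assms(1)])
  show "Ln holomorphic_on {z. 0 < Re z}"
    by (intro holomorphic_on_Ln) (auto simp: complex_nonpos_Reals_iff)
qed (use assms(2) open_halfspace_Re_gt in auto)

lemma linewise_holomorphic_on_translate:
  assumes f: "linewise_holomorphic_on f U" and V: "open V" "\<And>q. q \<in> V \<Longrightarrow> q + a \<in> U"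
  shows "linewise_holomorphic_on (\<lambda>q. f (q + a)) V"
  unfolding linewise_holomorphic_on_def
proof (intro conjI ballI allI V(1))
  show "continuous_on V (\<lambda>q. f (q + a))"
    using V(2) by (intro continuous_on_compose2[OF linewise_holomorphic_on_imp_continuous_on[OF f]]
        continuous_on_add continuous_on_id continuous_on_const) blast
  fix q e assume "q \<in> V"
  then have "(\<lambda>\<zeta>. f ((q + a) + cmul \<zeta> e)) field_differentiable at 0"
    using linewise_holomorphic_on_imp_field_differentiable[OF f V(2)] by blast
  then show "(\<lambda>\<zeta>. f (q + cmul \<zeta> e + a)) field_differentiable at 0" by (simp add: ac_simps)
qed

lemma line_in_open:
  assumes "open U" "q \<in> U"
  obtains r where "r > 0" "\<And>\<zeta>. \<zeta> \<in> cball 0 r \<Longrightarrow> q + cmul \<zeta> e \<in> U"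
proof -
  have "open ((\<lambda>\<zeta>. q + cmul \<zeta> e) -` U)"
    using assms(1) by (intro open_vimage) (auto intro!: continuous_intros)
  moreover have "0 \<in> (\<lambda>\<zeta>. q + cmul \<zeta> e) -` U" using assms(2) by simp
  ultimately obtain r where "r > 0" "cball 0 r \<subseteq> (\<lambda>\<zeta>. q + cmul \<zeta> e) -` U"
    using open_contains_cball by blast
  then show ?thesis using that by blast
qed

lemma line_derivative_uniform_limit:
  assumes f: "\<And>n. linewise_holomorphic_on (f n) U" and lim: "uniform_limit U f g sequentially"
    and q: "q \<in> U"
  obtains g' where "((\<lambda>\<zeta>. g (q + cmul \<zeta> e)) has_field_derivative g') (at 0)"
    "(\<lambda>n. dir_deriv e (f n) q) \<longlonglongrightarrow> g'"
proof -
  obtain r where r: "r > 0" "\<And>\<zeta>. \<zeta> \<in> cball 0 r \<Longrightarrow> q + cmul \<zeta> e \<in> U"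
    using line_in_open[OF linewise_holomorphic_on_imp_open[OF f] q] by metis
  have deriv: "((\<lambda>\<zeta>. f n (q + cmul \<zeta> e)) has_field_derivative dir_deriv e (f n) (q + cmul \<zeta> e)) (at \<zeta>)"
    if "\<zeta> \<in> cball 0 r" for n \<zeta>
    by (rule linewise_holomorphic_on_line_derivative[OF f r(2)[OF that]])
  have cont: "continuous_on (cball 0 r) (\<lambda>\<zeta>. f n (q + cmul \<zeta> e))" for n
    by (intro holomorphic_on_imp_continuous_on linewise_holomorphic_on_line[OF f r(2)])
  have "\<forall>\<^sub>F n in sequentially. continuous_on (cball 0 r) (\<lambda>\<zeta>. f n (q + cmul \<zeta> e)) \<and>
      (\<forall>\<zeta>\<in>ball 0 r. ((\<lambda>\<zeta>. f n (q + cmul \<zeta> e)) has_field_derivative dir_deriv e (f n) (q + cmul \<zeta> e)) (at \<zeta>))"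
    using cont deriv by (intro always_eventually) auto
  moreover have "uniform_limit (cball 0 r) (\<lambda>n \<zeta>. f n (q + cmul \<zeta> e)) (\<lambda>\<zeta>. g (q + cmul \<zeta> e)) sequentially"
    by (rule uniform_limit_compose'[OF lim]) (use r(2) in blast)
  ultimately obtain g' where "\<And>\<zeta>. \<zeta> \<in> ball 0 r \<Longrightarrow> ((\<lambda>\<zeta>. g (q + cmul \<zeta> e)) has_field_derivative g' \<zeta>) (at \<zeta>) \<and>
      (\<lambda>n. dir_deriv e (f n) (q + cmul \<zeta> e)) \<longlonglongrightarrow> g' \<zeta>"
    by (rule has_complex_derivative_uniform_limit[OF _ _ sequentially_bot r(1)]) blast
  from this[of 0] show ?thesis using that[of "g' 0"] r(1) by simp
qed

lemma linewise_holomorphic_on_uniform_limit: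
  assumes f: "\<And>n. linewise_holomorphic_on (f n) U" and lim: "uniform_limit U f g sequentially"
  shows "linewise_holomorphic_on g U"
  unfolding linewise_holomorphic_on_def
proof (intro conjI ballI allI)
  show "open U" by (rule linewise_holomorphic_on_imp_open[OF f])
  show "continuous_on U g"
    by (rule uniform_limit_theorem[OF _ lim]) (use f in \<open>auto simp: linewise_holomorphic_on_def\<close>)
  show "(\<lambda>\<zeta>. g (q + cmul \<zeta> e)) field_differentiable at 0" if "q \<in> U" for q e
    using line_derivative_uniform_limit[OF f lim that] unfolding field_differentiable_def by metis
qed

lemma dir_deriv_uniform_limit:
  assumes f: "\<And>n. linewise_holomorphic_on (f n) U" and lim: "uniform_limit U f g sequentially"
    and q: "q \<in> U"
  shows "(\<lambda>n. dir_deriv e (f n) q) \<longlonglongrightarrow> dir_deriv e g q"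
  using line_derivative_uniform_limit[OF f lim q, of e] unfolding dir_deriv_def by (metis DERIV_imp_deriv)

lemma cgrad_uniform_limit:
  assumes "\<And>n. linewise_holomorphic_on (f n) U" "uniform_limit U f g sequentially" "q \<in> U"
  shows "(\<lambda>n. cgrad (f n) q) \<longlonglongrightarrow> cgrad g q"
  unfolding cgrad_def by (intro tendsto_Pair dir_deriv_uniform_limit[OF assms])

lemma difference_quotient_bound:
  assumes g: "g holomorphic_on ball 0 d" and g_bound: "\<And>x. x \<in> ball 0 d \<Longrightarrow> cmod (g x) \<le> M"
    and h: "h \<noteq> 0" "cmod h < d/2"
  shows "cmod ((g h - g 0) / h - deriv g 0) \<le> 32 * M / d\<^sup>2 * cmod h"
proof -
  have d_pos: "d > 0" using h norm_ge_zero[of h] by linarith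
  have deriv: "((deriv ^^ i) g has_field_derivative (deriv ^^ Suc i) g x) (at x within ball 0 (d/2))"
    if "x \<in> ball 0 (d/2)" for i x
  proof -
    have "(deriv ^^ i) g holomorphic_on ball 0 d" by (intro holomorphic_higher_deriv g) auto
    moreover have "x \<in> ball 0 d" using that d_pos by auto
    ultimately show ?thesis
      by (auto intro: holomorphic_derivI open_ball has_field_derivative_at_within)
  qed
  have second_derivative_bound: "cmod ((deriv ^^ Suc 1) g x) \<le> fact (Suc 1) * M / (d/4) ^ Suc 1"
    if x: "x \<in> ball 0 (d/2)" for x
  proof (rule Cauchy_inequality)
    have cball_subset: "cball x (d/4) \<subseteq> ball 0 d"
      using x d_pos by (simp add: cball_subset_ball_iff dist_commute)
    then show "g holomorphic_on ball x (d/4)" using g by (meson ball_subset_cball holomorphic_on_subset)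
    show "continuous_on (cball x (d/4)) g"
      using g cball_subset by (blast intro: holomorphic_on_imp_continuous_on holomorphic_on_subset)
    show "cmod (g y) \<le> M" if "cmod (x - y) = d/4" for y
      using that cball_subset by (intro g_bound) (auto simp: dist_norm)
  qed (use d_pos in simp)
  have "cmod ((deriv ^^ 0) g h - (\<Sum>i\<le>1. (deriv ^^ i) g 0 * (h - 0) ^ i / fact i))
      \<le> (fact (Suc 1) * M / (d/4) ^ Suc 1) * cmod (h - 0) ^ Suc 1 / fact 1"
    by (rule complex_Taylor[of "ball 0 (d/2)" 1 "\<lambda>i. (deriv ^^ i) g"]) (use deriv second_derivative_bound h d_pos in auto)
  then have taylor: "cmod (g h - g 0 - deriv g 0 * h) \<le> 32 * M / d\<^sup>2 * (cmod h)\<^sup>2"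
    by (simp add: power2_eq_square field_simps)
  have "(g h - g 0) / h - deriv g 0 = (g h - g 0 - deriv g 0 * h) / h"
    using h by (simp add: field_simps)
  then show ?thesis using h taylor
    by (simp add: norm_divide divide_le_eq power2_eq_square mult.assoc)
qed

lemma linewise_holomorphic_on_locally_bounded_line:
  assumes f: "linewise_holomorphic_on f U" and p: "p \<in> U"
  obtains V d M where "open V" "p \<in> V" "V \<subseteq> U" "d > 0"
    "\<And>q \<zeta>. q \<in> V \<Longrightarrow> cmod \<zeta> < d \<Longrightarrow> q + cmul \<zeta> e \<in> U"
    "\<And>q \<zeta>. q \<in> V \<Longrightarrow> cmod \<zeta> < d \<Longrightarrow> cmod (f (q + cmul \<zeta> e)) \<le> M"
proof -
  obtain R where R: "R > 0" "cball p R \<subseteq> U"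
    using linewise_holomorphic_on_imp_open[OF f] p open_contains_cball by blast
  have "continuous_on (cball p R) f"
    using linewise_holomorphic_on_imp_continuous_on[OF f] R(2) continuous_on_subset by blast
  then have "bounded (f ` cball p R)"
    by (intro compact_imp_bounded compact_continuous_image) simp_all
  then obtain M where f_bound: "\<And>q. q \<in> cball p R \<Longrightarrow> cmod (f q) \<le> M"
    unfolding bounded_iff by blast
  define d where "d = R / (2 * (norm e + 1))"
  have d_pos: "d > 0" using R(1) by (simp add: d_def add_nonneg_pos)
  have near: "q + cmul \<zeta> e \<in> cball p R" if "q \<in> ball p (R/2)" "cmod \<zeta> < d" for q \<zeta>
  proof -
    have "cmod \<zeta> * norm e \<le> d * (norm e + 1)" using that(2) d_pos by (intro mult_mono) auto
    also have "\<dots> = R/2" by (simp add: d_def field_simps add_nonneg_eq_0_iff)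
    finally have "norm (cmul \<zeta> e) \<le> R/2" by (simp add: norm_cmul)
    then show ?thesis
      using that(1) norm_triangle_ineq4[of "p - q" "cmul \<zeta> e"] by (simp add: dist_norm algebra_simps)
  qed
  have "ball p (R/2) \<subseteq> cball p R" using R(1) by auto
  then have "ball p (R/2) \<subseteq> U" using R(2) by blast
  moreover have "p \<in> ball p (R/2)" using R(1) by simp
  ultimately show ?thesis using that[OF open_ball _ _ d_pos] near f_bound R(2) by blast
qed

lemma linewise_holomorphic_on_dir_deriv:
  assumes f: "linewise_holomorphic_on f U"
  shows "linewise_holomorphic_on (dir_deriv e f) U"
proof (rule linewise_holomorphic_on_local[OF linewise_holomorphic_on_imp_open[OF f]])
  fix p assume "p \<in> U"
  then obtain V d M where V: "open V" "p \<in> V" "V \<subseteq> U" and d_pos: "d > 0"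
    and in_U: "\<And>q \<zeta>. q \<in> V \<Longrightarrow> cmod \<zeta> < d \<Longrightarrow> q + cmul \<zeta> e \<in> U"
    and f_bound: "\<And>q \<zeta>. q \<in> V \<Longrightarrow> cmod \<zeta> < d \<Longrightarrow> cmod (f (q + cmul \<zeta> e)) \<le> M"
    using linewise_holomorphic_on_locally_bounded_line[OF f] by metis
  define h where "h n = complex_of_real (d / (real n + 3))" for n
  have h_small: "h n \<noteq> 0" "cmod (h n) < d/2" "cmod (h n) = d / (real n + 3)" for n
    using d_pos unfolding h_def norm_of_real
    by (auto simp: field_simps add_pos_nonneg simp del: of_real_divide of_real_add)
  define Q where "Q n q = (f (q + cmul (h n) e) + (- 1) * f q) * (1 / h n)" for n q
  have Q_holomorphic: "linewise_holomorphic_on (Q n) V" for n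
    unfolding Q_def using h_small(2)[of n] d_pos in_U V
    by (intro linewise_holomorphic_on_mult linewise_holomorphic_on_add linewise_holomorphic_on_const
        linewise_holomorphic_on_translate[OF f] linewise_holomorphic_on_subset[OF f]) auto
  have bound: "dist (Q n q) (dir_deriv e f q) \<le> 32 * M / d\<^sup>2 * (d / (real n + 3))" if q: "q \<in> V" for n q
  proof -
    have "(\<lambda>\<zeta>. f (q + cmul \<zeta> e)) holomorphic_on ball 0 d"
      by (rule linewise_holomorphic_on_line[OF f]) (use in_U[OF q] in auto)
    from difference_quotient_bound[OF this _ h_small(1,2)] show ?thesis
      using f_bound[OF q] by (simp add: Q_def dir_deriv_def h_small(3) dist_norm)
  qed
  have "(\<lambda>n. 32 * M / d\<^sup>2 * (d / (real n + 3))) \<longlonglongrightarrow> 0" by real_asymp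
  then have "uniform_limit V Q (dir_deriv e f) sequentially"
    by (intro uniform_limitI) (auto dest!: order_tendstoD(2) elim!: eventually_mono intro: le_less_trans[OF bound])
  then have "linewise_holomorphic_on (dir_deriv e f) V" by (rule linewise_holomorphic_on_uniform_limit[OF Q_holomorphic])
  then show "\<exists>V. p \<in> V \<and> linewise_holomorphic_on (dir_deriv e f) V" using V(2) by blast
qed

lemma linewise_holomorphic_on_partial_derivatives:
  assumes f: "linewise_holomorphic_on f U" and "(x, y) \<in> U"
  shows "((\<lambda>x. f (x, y)) has_field_derivative dir_deriv (1, 0) f (x, y)) (at x)"
    and "((\<lambda>y. f (x, y)) has_field_derivative dir_deriv (0, 1) f (x, y)) (at y)"
  using linewise_holomorphic_on_line_derivative[OF f, of "(0, y)" x "(1, 0)"]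
    linewise_holomorphic_on_line_derivative[OF f, of "(x, 0)" y "(0, 1)"] assms(2)
  by (simp_all add: cmul_def)

lemma linewise_holomorphic_on_has_derivative:
  assumes f: "linewise_holomorphic_on f U" and q: "q \<in> U"
  shows "(f has_derivative cdot (cgrad f q)) (at q)"
proof -
  define f1 f2 where "f1 = dir_deriv (1, 0) f" and "f2 = dir_deriv (0, 1) f"
  obtain x0 y0 where q_eq: "q = (x0, y0)" by (cases q)
  obtain A B where AB: "open A" "open B" "q \<in> A \<times> B" "A \<times> B \<subseteq> U"
    using open_prod_elim[OF linewise_holomorphic_on_imp_open[OF f] q] by metis
  then have "y0 \<in> B" by (simp add: q_eq)
  then obtain r where r: "r > 0" "ball y0 r \<subseteq> B" using AB(2) open_contains_ball by blast
  define Y where "Y = ball y0 r"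
  have Y: "open Y" "convex Y" "y0 \<in> Y" "A \<times> Y \<subseteq> U" using r AB(4) by (auto simp: Y_def)
  have "((\<lambda>(x, y). f (x, y)) has_derivative
      (\<lambda>(v1, v2). f1 q * v1 + blinfun_apply (blinfun_mult_right (f2 q)) v2)) (at (x0, y0) within A \<times> Y)"
    unfolding q_eq
  proof (rule has_derivative_partialsI)
    show "((\<lambda>x. f (x, y0)) has_derivative (*) (f1 (x0, y0))) (at x0 within A)"
      using linewise_holomorphic_on_partial_derivatives(1)[OF f q[unfolded q_eq]]
      unfolding has_field_derivative_def f1_def by (rule has_derivative_at_withinI)
    show "((\<lambda>y. f (x, y)) has_derivative blinfun_apply (blinfun_mult_right (f2 (x, y)))) (at y within Y)"
      if "x \<in> A" "y \<in> Y" for x y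
    proof -
      have "(x, y) \<in> U" using that Y(4) by auto
      from linewise_holomorphic_on_partial_derivatives(2)[OF f this] show ?thesis
        unfolding has_field_derivative_def f2_def blinfun_mult_right.rep_eq by (rule has_derivative_at_withinI)
    qed
    have "continuous_on U f2"
      unfolding f2_def by (intro linewise_holomorphic_on_imp_continuous_on linewise_holomorphic_on_dir_deriv f)
    then have "continuous (at q within A \<times> Y) f2"
      using q by (simp add: continuous_on_eq_continuous_at[OF linewise_holomorphic_on_imp_open[OF f]]
          continuous_at_imp_continuous_at_within)
    from bounded_linear.continuous[OF bounded_linear_blinfun_mult_right this]
    show "continuous (at (x0, y0) within A \<times> Y) (\<lambda>(x, y). blinfun_mult_right (f2 (x, y)))"
      by (simp add: case_prod_unfold q_eq)
  qed (use Y in auto)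
  moreover have "at (x0, y0) within A \<times> Y = at q"
    using AB Y by (subst at_within_open) (auto simp: open_Times q_eq)
  moreover have "(\<lambda>(v1, v2). f1 q * v1 + blinfun_apply (blinfun_mult_right (f2 q)) v2) = cdot (cgrad f q)"
    by (auto simp: cdot_def cgrad_def f1_def f2_def blinfun_mult_right.rep_eq)
  ultimately show ?thesis by (simp add: case_prod_unfold)
qed

lemma cgrad_eq_if_exp_eq:
  assumes h: "linewise_holomorphic_on h W" and exp_h: "\<And>q. q \<in> W \<Longrightarrow> exp (c * h q) = f q" and q: "q \<in> W"
  shows "cgrad f q = cmul (c * f q) (cgrad h q)"
proof (rule cgrad_eqI)
  have "((\<lambda>q. c * h q) has_derivative (\<lambda>v. c * cdot (cgrad h q) v)) (at q)"
    by (intro has_derivative_mult_right linewise_holomorphic_on_has_derivative[OF h q])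
  from has_derivative_compose[OF this DERIV_exp[unfolded has_field_derivative_def]]
  have "((\<lambda>q. exp (c * h q)) has_derivative (\<lambda>v. exp (c * h q) * (c * cdot (cgrad h q) v))) (at q)" .
  then have "(f has_derivative (\<lambda>v. exp (c * h q) * (c * cdot (cgrad h q) v))) (at q)"
    by (rule has_derivative_transform_within_open[OF _ linewise_holomorphic_on_imp_open[OF h] q exp_h])
  moreover have "(\<lambda>v. exp (c * h q) * (c * cdot (cgrad h q) v)) = cdot (cmul (c * f q) (cgrad h q))"
    by (auto simp: exp_h[OF q] cdot_cmul_left)
  ultimately show "(f has_derivative cdot (cmul (c * f q) (cgrad h q))) (at q)" by simp
qed

subsection \<open>Pluriharmonic defining functions\<close>

lemma has_derivative_Re_linewise_holomorphic:
  assumes "linewise_holomorphic_on f U" "q \<in> U"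
  shows "((\<lambda>q. Re (f q)) has_derivative (\<lambda>v. Re (cdot (cgrad f q) v))) (at q)"
  by (rule bounded_linear.has_derivative[OF bounded_linear_Re linewise_holomorphic_on_has_derivative[OF assms]])

lemma frechet_derivative_Re_linewise_holomorphic:
  assumes "linewise_holomorphic_on f U" "q \<in> U"
  shows "frechet_derivative (\<lambda>q. Re (f q)) (at q) = (\<lambda>v. Re (cdot (cgrad f q) v))"
  using frechet_derivative_at[OF has_derivative_Re_linewise_holomorphic[OF assms]] by simp

lemma Ck_on_cong:
  assumes "open U" "\<And>q. q \<in> U \<Longrightarrow> f q = g q" "Ck_on k f U"
  shows "Ck_on k g U"
  using assms(2,3)
proof (induction k arbitrary: f g)
  case 0
  then show ?case by (auto intro: continuous_on_eq)
next
  case (Suc k)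
  have deriv: "(g has_derivative frechet_derivative f (at q)) (at q)" if "q \<in> U" for q
  proof -
    have "(f has_derivative frechet_derivative f (at q)) (at q)"
      using Suc.prems(2) that frechet_derivative_works unfolding Ck_on.simps by blast
    then show ?thesis
      by (rule has_derivative_transform_within_open[OF _ assms(1) that]) (simp add: Suc.prems(1))
  qed
  have "Ck_on k (\<lambda>z. frechet_derivative g (at z) v) U" for v
  proof (rule Suc.IH)
    show "Ck_on k (\<lambda>z. frechet_derivative f (at z) v) U" using Suc.prems(2) unfolding Ck_on.simps by blast
    show "frechet_derivative f (at q) v = frechet_derivative g (at q) v" if "q \<in> U" for q
      using frechet_derivative_at[OF deriv[OF that]] by simp
  qed
  then show ?case using deriv unfolding Ck_on.simps differentiable_def by blast
qed

lemma Ck_on_Re_linewise_holomorphic: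
  assumes "linewise_holomorphic_on f U"
  shows "Ck_on k (\<lambda>q. Re (f q)) U"
  using assms
proof (induction k arbitrary: f)
  case 0
  then show ?case by (auto simp: linewise_holomorphic_on_def intro!: continuous_intros)
next
  case (Suc k)
  have "Ck_on k (\<lambda>z. frechet_derivative (\<lambda>q. Re (f q)) (at z) v) U" for v
  proof (rule Ck_on_cong[OF linewise_holomorphic_on_imp_open[OF Suc.prems]])
    show "Ck_on k (\<lambda>q. Re (dir_deriv v f q)) U"
      by (rule Suc.IH[OF linewise_holomorphic_on_dir_deriv[OF Suc.prems]])
    show "Re (dir_deriv v f q) = frechet_derivative (\<lambda>q. Re (f q)) (at q) v" if "q \<in> U" for q
      using dir_deriv_eqI[OF linewise_holomorphic_on_has_derivative[OF Suc.prems that]]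
      by (simp add: frechet_derivative_Re_linewise_holomorphic[OF Suc.prems that])
  qed
  then show ?case
    using has_derivative_Re_linewise_holomorphic[OF Suc.prems]
    unfolding Ck_on.simps differentiable_def by blast
qed

lemma smooth_boundary_if_locally_pluriharmonic:
  assumes "\<And>p. p \<in> frontier \<Omega> \<Longrightarrow> \<exists>W f. p \<in> W \<and> linewise_holomorphic_on f W \<and>
      \<Omega> \<inter> W = {q\<in>W. Re (f q) < 0} \<and> (\<forall>q\<in>W. cgrad f q \<noteq> 0)"
  shows "smooth_boundary \<Omega>"
  unfolding smooth_boundary_def
proof
  fix p assume p: "p \<in> frontier \<Omega>"
  obtain W f where W: "p \<in> W" "\<Omega> \<inter> W = {q\<in>W. Re (f q) < 0}"
    and f: "linewise_holomorphic_on f W" and grad: "\<And>q. q \<in> W \<Longrightarrow> cgrad f q \<noteq> 0"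
    using assms[OF p] by blast
  have nondegenerate: "frechet_derivative (\<lambda>q. Re (f q)) (at q) \<noteq> (\<lambda>_. 0)" if q: "q \<in> W" for q
  proof
    assume "frechet_derivative (\<lambda>q. Re (f q)) (at q) = (\<lambda>_. 0)"
    then have "Re (cdot (cgrad f q) v) = 0" for v
      unfolding frechet_derivative_Re_linewise_holomorphic[OF f q] by (rule fun_cong)
    from this[of "(cnj (fst (cgrad f q)), cnj (snd (cgrad f q)))"] show False
      using grad[OF q] unfolding cdot_cnj by simp
  qed
  show "\<exists>U \<rho>. open U \<and> p \<in> U \<and> (\<forall>k. Ck_on k \<rho> U) \<and>
      \<Omega> \<inter> U = {z\<in>U. \<rho> z < 0} \<and> (\<forall>z\<in>U. frechet_derivative \<rho> (at z) \<noteq> (\<lambda>_. 0))"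
  proof (intro exI conjI)
    show "\<Omega> \<inter> W = {q\<in>W. Re (f q) < 0}" by (rule W(2))
    show "\<forall>k. Ck_on k (\<lambda>q. Re (f q)) W" using Ck_on_Re_linewise_holomorphic[OF f] by blast
  qed (use W(1) linewise_holomorphic_on_imp_open[OF f] nondegenerate in blast)+
qed

subsection \<open>Compositions of Henon maps\<close>

definition henon :: "complex \<Rightarrow> C2 \<Rightarrow> C2" where
  "henon c q = ((fst q)\<^sup>2 + c * snd q, fst q)"

lemma henon_has_derivative:
  "(henon c has_derivative (\<lambda>v. (2 * fst q * fst v + c * snd v, fst v))) (at q)"
  unfolding henon_def[abs_def] by (auto intro!: derivative_eq_intros)

lemma holomorphic_automorphism_henon:
  assumes "c \<noteq> 0"
  shows "holomorphic_automorphism (henon c)"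
proof (rule holomorphic_automorphismI)
  define K :: "C2 \<Rightarrow> C2" where "K = (\<lambda>q. (snd q, (fst q - (snd q)\<^sup>2) / c))"
  have "(K has_derivative (\<lambda>v. (snd v, (fst v - 2 * snd q * snd v) / c))) (at q)" for q
    unfolding K_def by (auto intro!: derivative_eq_intros simp: assms)
  then show "hol2 K UNIV"
    unfolding hol2_def
    by (intro ballI exI conjI allI, assumption) (simp add: cmul_def diff_divide_distrib algebra_simps)
  show "hol2 (henon c) UNIV"
    unfolding hol2_def
    by (intro ballI exI conjI allI, rule henon_has_derivative) (simp add: cmul_def algebra_simps)
  show "henon c (K q) = q" "K (henon c q) = q" for q
    using assms by (auto simp: henon_def K_def)
qed

lemma attracting_fixed_point_at_0_henon:
  assumes "cmod c < 1"
  shows "attracting_fixed_point_at_0 (henon c)"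
proof -
  have deriv: "frechet_derivative (henon c) (at 0) = (\<lambda>v. (c * snd v, fst v))"
    using frechet_derivative_at[OF henon_has_derivative[of c 0]] by simp
  have "cmod e < 1" if "v \<noteq> 0" "(c * snd v, fst v) = cmul e v" for e v
  proof -
    have eigen: "c * snd v = e * fst v" "fst v = e * snd v" using that by (auto simp: cmul_def)
    then have "snd v \<noteq> 0" using that(1) by (auto simp: prod_eq_iff)
    moreover have "c * snd v = e\<^sup>2 * snd v" using eigen by (simp add: power2_eq_square)
    ultimately have "(cmod e)\<^sup>2 < 1\<^sup>2" using assms by (simp add: norm_power)
    then show ?thesis using power2_less_imp_less by fastforce
  qed
  moreover have "henon c 0 = 0" by (simp add: henon_def zero_prod_def)
  ultimately show ?thesis
    unfolding attracting_fixed_point_at_0_def deriv by blast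
qed

fun henon_poly :: "(nat \<Rightarrow> complex) \<Rightarrow> nat \<Rightarrow> C2 \<Rightarrow> complex" where
  "henon_poly a 0 = snd"
| "henon_poly a (Suc 0) = fst"
| "henon_poly a (Suc (Suc n)) = (\<lambda>q. (henon_poly a (Suc n) q)\<^sup>2 + a n * henon_poly a n q)"

declare henon_poly.simps(3) [simp del]

lemma henon_poly_cong:
  "(\<And>i. Suc i < n \<Longrightarrow> a i = b i) \<Longrightarrow> henon_poly a n = henon_poly b n"
  by (induction n rule: induct_nat_012) (auto simp: henon_poly.simps(3))

lemma henon_poly_at_0: "henon_poly a n 0 = 0"
  by (induction n rule: induct_nat_012) (auto simp: henon_poly.simps(3))

lemma linewise_holomorphic_on_henon_poly: "open U \<Longrightarrow> linewise_holomorphic_on (henon_poly a n) U"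
  by (induction n rule: induct_nat_012)
    (simp_all add: linewise_holomorphic_on_fst linewise_holomorphic_on_snd linewise_holomorphic_on_const
      linewise_holomorphic_on_add linewise_holomorphic_on_mult henon_poly.simps(3) power2_eq_square)

lemma continuous_on_henon_poly: "continuous_on S (henon_poly a n)"
  using linewise_holomorphic_on_imp_continuous_on[OF linewise_holomorphic_on_henon_poly[OF open_UNIV]]
  by (rule continuous_on_subset) simp

lemma henon_poly_has_derivative: "(henon_poly a n has_derivative cdot (cgrad (henon_poly a n) q)) (at q)"
  by (rule linewise_holomorphic_on_has_derivative[OF linewise_holomorphic_on_henon_poly[OF open_UNIV]]) simp

lemma continuous_on_cgrad_henon_poly: "continuous_on S (cgrad (henon_poly a n))"
proof -
  have "continuous_on UNIV (cgrad (henon_poly a n))"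
    unfolding cgrad_def
    by (intro continuous_on_Pair linewise_holomorphic_on_imp_continuous_on
        linewise_holomorphic_on_dir_deriv linewise_holomorphic_on_henon_poly) auto
  then show ?thesis by (rule continuous_on_subset) simp
qed

lemma cgrad_square_plus:
  assumes "(f has_derivative cdot (cgrad f q)) (at q)" "(g has_derivative cdot (cgrad g q)) (at q)"
  shows "cgrad (\<lambda>q. (g q)\<^sup>2 + c * f q) q = cmul (2 * g q) (cgrad g q) + cmul c (cgrad f q)"
proof (rule cgrad_eqI)
  have "((\<lambda>q. (g q)\<^sup>2 + c * f q) has_derivative (\<lambda>v. 2 * g q * cdot (cgrad g q) v + c * cdot (cgrad f q) v)) (at q)"
    by (auto intro!: derivative_eq_intros assms)
  moreover have "(\<lambda>v. 2 * g q * cdot (cgrad g q) v + c * cdot (cgrad f q) v) =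
      cdot (cmul (2 * g q) (cgrad g q) + cmul c (cgrad f q))"
    by (simp add: fun_eq_iff cdot_add_left cdot_cmul_left)
  ultimately show "((\<lambda>q. (g q)\<^sup>2 + c * f q) has_derivative
      cdot (cmul (2 * g q) (cgrad g q) + cmul c (cgrad f q))) (at q)" by simp
qed

lemma cgrad_henon_poly_Suc_Suc:
  "cgrad (henon_poly a (Suc (Suc n))) q =
    cmul (2 * henon_poly a (Suc n) q) (cgrad (henon_poly a (Suc n)) q) + cmul (a n) (cgrad (henon_poly a n) q)"
  unfolding henon_poly.simps by (rule cgrad_square_plus[OF henon_poly_has_derivative henon_poly_has_derivative])

text \<open>The Jacobian determinant of two consecutive polynomials is multiplied by \<open>- a n\<close> in each step.\<close>

lemma cgrad_henon_poly_nonzero: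
  assumes "\<And>i. i < n \<Longrightarrow> a i \<noteq> 0"
  shows "cgrad (henon_poly a n) q \<noteq> 0" and "cgrad (henon_poly a (Suc n)) q \<noteq> 0"
proof -
  define G where "G n = cgrad (henon_poly a n) q" for n
  have "fst (G n) * snd (G (Suc n)) \<noteq> snd (G n) * fst (G (Suc n))"
    using assms
  proof (induction n)
    case 0
    have "G 0 = (0, 1)" "G (Suc 0) = (1, 0)"
      unfolding G_def by (auto intro!: cgrad_eqI derivative_eq_intros simp: cdot_def)
    then show ?case by simp
  next
    case (Suc n)
    have "fst (G n) * snd (G (Suc n)) \<noteq> snd (G n) * fst (G (Suc n))" by (rule Suc.IH) (simp add: Suc.prems)
    moreover have "snd (G (Suc n)) * fst (G (Suc (Suc n))) - fst (G (Suc n)) * snd (G (Suc (Suc n))) =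
        a n * (fst (G n) * snd (G (Suc n)) - snd (G n) * fst (G (Suc n)))"
      unfolding G_def cgrad_henon_poly_Suc_Suc by (simp add: cmul_def algebra_simps)
    ultimately show ?case using Suc.prems[of n] by auto
  qed
  then show "cgrad (henon_poly a n) q \<noteq> 0" "cgrad (henon_poly a (Suc n)) q \<noteq> 0"
    unfolding G_def by auto
qed

locale henon_sequence =
  fixes a :: "nat \<Rightarrow> complex"
  assumes a_nonzero: "a n \<noteq> 0" and norm_a_le: "cmod (a n) \<le> 1/16"
begin

abbreviation P :: "nat \<Rightarrow> C2 \<Rightarrow> complex" where
  "P \<equiv> henon_poly a"

definition F :: "nat \<Rightarrow> C2 \<Rightarrow> C2" where
  "F n = henon (a n)"

text \<open>With these weights the unit ball is mapped into itself from one step to the next.\<close>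

definition scaled_comp :: "nat \<Rightarrow> C2 \<Rightarrow> C2" where
  "scaled_comp n q = (4 * P (Suc (Suc n)) q, 2 * P (Suc n) q)"

lemma comp_seq_F: "comp_seq F n q = (P (Suc (Suc n)) q, P (Suc n) q)"
  by (induction n) (simp_all add: F_def henon_def henon_poly.simps(3))

lemma holomorphic_automorphism_F: "holomorphic_automorphism (F n)"
  unfolding F_def by (rule holomorphic_automorphism_henon[OF a_nonzero])

lemma attracting_fixed_point_at_0_F: "attracting_fixed_point_at_0 (F n)"
  unfolding F_def by (rule attracting_fixed_point_at_0_henon) (use norm_a_le[of n] in simp)

lemma holomorphic_automorphism_comp_seq: "holomorphic_automorphism (comp_seq F n)"
proof (induction n)
  case (Suc n)
  then show ?case
    unfolding comp_seq.simps by (rule holomorphic_automorphism_compose[OF holomorphic_automorphism_F])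
qed (simp add: holomorphic_automorphism_F)

lemma holomorphic_automorphism_scaled_comp: "holomorphic_automorphism (scaled_comp n)"
proof -
  have "scaled_comp n = (\<lambda>q. (4 * fst q, 2 * snd q)) \<circ> comp_seq F n"
    by (simp add: fun_eq_iff scaled_comp_def comp_seq_F)
  then show ?thesis
    using holomorphic_automorphism_compose[OF holomorphic_automorphism_diagonal holomorphic_automorphism_comp_seq]
    by simp
qed

lemma scaled_comp_contracts:
  assumes "norm (scaled_comp n q) < 1"
  shows "(norm (scaled_comp (Suc n) q))\<^sup>2 \<le> (norm (scaled_comp n q))\<^sup>2 / 2"
proof -
  define X where "X = 4 * P (Suc (Suc n)) q"
  define Y where "Y = 2 * P (Suc n) q"
  have scaled_eq: "scaled_comp n q = (X, Y)" by (simp add: scaled_comp_def X_def Y_def)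
  have scaled_Suc: "scaled_comp (Suc n) q = (X\<^sup>2 / 4 + 2 * a (Suc n) * Y, X / 2)"
    by (simp add: scaled_comp_def X_def Y_def henon_poly.simps(3)[of a "Suc n"] power2_eq_square)
  have "cmod X < 1" using assms norm_fst_le[of X Y] unfolding scaled_eq by linarith
  have "cmod (X\<^sup>2 / 4 + 2 * a (Suc n) * Y) \<le> cmod X * cmod X / 4 + 2 * cmod (a (Suc n)) * cmod Y"
    using norm_triangle_ineq[of "X\<^sup>2 / 4" "2 * a (Suc n) * Y"]
    by (simp add: norm_divide norm_power norm_mult power2_eq_square)
  also have "\<dots> \<le> cmod X / 4 + cmod Y / 8"
    using mult_left_le[of "cmod X" "cmod X"] \<open>cmod X < 1\<close> mult_right_mono[OF norm_a_le[of "Suc n"] norm_ge_zero[of Y]]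
    by simp
  finally have "(cmod (X\<^sup>2 / 4 + 2 * a (Suc n) * Y))\<^sup>2 \<le> (cmod X / 4 + cmod Y / 8)\<^sup>2"
    by (rule power_mono) simp
  moreover have "(cmod X)\<^sup>2 / 4 + (cmod Y)\<^sup>2 / 2 - (cmod X / 4 + cmod Y / 8)\<^sup>2 =
      (cmod X - cmod Y)\<^sup>2 / 32 + 5 / 32 * (cmod X)\<^sup>2 + 29 / 64 * (cmod Y)\<^sup>2"
    by (simp add: power2_eq_square field_simps)
  then have "0 \<le> (cmod X)\<^sup>2 / 4 + (cmod Y)\<^sup>2 / 2 - (cmod X / 4 + cmod Y / 8)\<^sup>2" by simp
  moreover have "(norm (scaled_comp (Suc n) q))\<^sup>2 = (cmod (X\<^sup>2 / 4 + 2 * a (Suc n) * Y))\<^sup>2 + (cmod X)\<^sup>2 / 4"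
    unfolding scaled_Suc by (simp add: norm_prod_def norm_divide power_divide)
  moreover have "(norm (scaled_comp n q))\<^sup>2 = (cmod X)\<^sup>2 + (cmod Y)\<^sup>2" by (simp add: scaled_eq norm_prod_def)
  ultimately show ?thesis by argo
qed

lemma scaled_comp_in_ball_Suc:
  assumes "norm (scaled_comp n q) < 1"
  shows "norm (scaled_comp (Suc n) q) < 1"
proof -
  have "(norm (scaled_comp n q))\<^sup>2 < 1" using assms by (simp add: power_less_one_iff)
  then have "(norm (scaled_comp (Suc n) q))\<^sup>2 < 1"
    using scaled_comp_contracts[OF assms] zero_le_power2[of "norm (scaled_comp n q)"] by linarith
  then show ?thesis by (simp add: power_less_one_iff)
qed

lemma basin_iff_P_tendsto_0: "q \<in> nonautonomous_basin F \<longleftrightarrow> (\<lambda>n. P n q) \<longlonglongrightarrow> 0"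
proof
  assume "q \<in> nonautonomous_basin F"
  then have "(\<lambda>n. (P (Suc (Suc n)) q, P (Suc n) q)) \<longlonglongrightarrow> (0, 0)"
    unfolding nonautonomous_basin_def comp_seq_F zero_prod_def by simp
  from tendsto_snd[OF this] show "(\<lambda>n. P n q) \<longlonglongrightarrow> 0" by (simp add: LIMSEQ_imp_Suc)
next
  assume "(\<lambda>n. P n q) \<longlonglongrightarrow> 0"
  then show "q \<in> nonautonomous_basin F"
    unfolding nonautonomous_basin_def comp_seq_F zero_prod_def mem_Collect_eq
    by (intro tendsto_Pair LIMSEQ_Suc)
qed

lemma scaled_comp_tendsto_0_iff: "(\<lambda>n. scaled_comp n q) \<longlonglongrightarrow> 0 \<longleftrightarrow> q \<in> nonautonomous_basin F"
proof
  assume "(\<lambda>n. scaled_comp n q) \<longlonglongrightarrow> 0"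
  from tendsto_divide[OF tendsto_snd[OF this] tendsto_const[of 2]]
  have "(\<lambda>n. P (Suc n) q) \<longlonglongrightarrow> 0" by (simp add: scaled_comp_def)
  then show "q \<in> nonautonomous_basin F" unfolding basin_iff_P_tendsto_0 by (rule LIMSEQ_imp_Suc)
next
  assume "q \<in> nonautonomous_basin F"
  then show "(\<lambda>n. scaled_comp n q) \<longlonglongrightarrow> 0"
    unfolding scaled_comp_def zero_prod_def basin_iff_P_tendsto_0
    by (intro tendsto_Pair tendsto_mult_right_zero LIMSEQ_Suc)
qed

lemma eventually_norm_scaled_comp_less:
  assumes "q \<in> nonautonomous_basin F" "r > 0"
  shows "\<forall>\<^sub>F n in sequentially. norm (scaled_comp n q) < r"
proof -
  have "(\<lambda>n. norm (scaled_comp n q)) \<longlonglongrightarrow> 0"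
    using assms(1) scaled_comp_tendsto_0_iff by (intro tendsto_norm_zero) blast
  then show ?thesis using assms(2) by (rule order_tendstoD)
qed

lemma scaled_comp_tendsto_0:
  assumes "norm (scaled_comp n q) < 1"
  shows "(\<lambda>m. scaled_comp m q) \<longlonglongrightarrow> 0"
proof -
  have "norm (scaled_comp (n + m) q) < 1 \<and> (norm (scaled_comp (n + m) q))\<^sup>2 \<le> (1/2) ^ m" for m
  proof (induction m)
    case 0
    then show ?case using assms by (simp add: power_le_one_iff)
  next
    case (Suc m)
    then show ?case
      using scaled_comp_contracts[of "n + m" q] scaled_comp_in_ball_Suc[of "n + m" q] by simp
  qed
  then have "\<forall>\<^sub>F m in sequentially. norm ((norm (scaled_comp (n + m) q))\<^sup>2) \<le> (1/2) ^ m" by simp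
  then have "(\<lambda>m. (norm (scaled_comp (n + m) q))\<^sup>2) \<longlonglongrightarrow> 0"
    by (rule Lim_null_comparison) (rule LIMSEQ_power_zero, simp)
  from tendsto_real_sqrt[OF this] have "(\<lambda>m. norm (scaled_comp (n + m) q)) \<longlonglongrightarrow> 0" by simp
  then have "(\<lambda>m. scaled_comp (m + n) q) \<longlonglongrightarrow> 0" by (simp add: tendsto_norm_zero_cancel add.commute)
  then show ?thesis by (rule LIMSEQ_offset)
qed

lemma basin_eq_Union: "nonautonomous_basin F = (\<Union>n. scaled_comp n -` ball 0 1)"
proof (intro equalityI subsetI)
  fix q assume "q \<in> nonautonomous_basin F"
  then obtain n where "norm (scaled_comp n q) < 1"
    using eventually_norm_scaled_comp_less eventually_happens'[OF sequentially_bot] zero_less_one by blast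
  then show "q \<in> (\<Union>n. scaled_comp n -` ball 0 1)" by auto
next
  fix q assume "q \<in> (\<Union>n. scaled_comp n -` ball 0 1)"
  then obtain n where "norm (scaled_comp n q) < 1" by auto
  then show "q \<in> nonautonomous_basin F"
    unfolding scaled_comp_tendsto_0_iff[symmetric] by (rule scaled_comp_tendsto_0)
qed

lemma basin_increasing_union_of_balls:
  "\<exists>W. (\<forall>j. W j \<subseteq> W (Suc j)) \<and> nonautonomous_basin F = (\<Union>j. W j) \<and> (\<forall>j::nat. biholomorphic_to_ball (W j))"
proof (intro exI conjI allI)
  show "scaled_comp j -` ball 0 1 \<subseteq> scaled_comp (Suc j) -` ball 0 1" for j
    using scaled_comp_in_ball_Suc by auto
qed (rule basin_eq_Union biholomorphic_to_ball_vimage[OF holomorphic_automorphism_scaled_comp])+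

lemma open_basin: "open (nonautonomous_basin F)"
  unfolding basin_eq_Union using biholomorphic_to_ball_vimage[OF holomorphic_automorphism_scaled_comp]
  by (auto simp: biholomorphic_to_ball_def)

lemma connected_basin: "connected (nonautonomous_basin F)"
  unfolding basin_eq_Union
proof (rule connected_Union)
  have "0 \<in> \<Inter> (range (\<lambda>n. scaled_comp n -` ball 0 1))"
    by (simp add: scaled_comp_def henon_poly_at_0 zero_prod_def[symmetric])
  then show "\<Inter> (range (\<lambda>n. scaled_comp n -` ball 0 1)) \<noteq> {}" by blast
qed (use connected_vimage_ball_automorphism[OF holomorphic_automorphism_scaled_comp] in auto)

lemma derivative_P_tendsto_0:
  assumes "q \<in> nonautonomous_basin F"
  shows "(\<lambda>n. cdot (cgrad (P n) q) v) \<longlonglongrightarrow> 0"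
proof (rule linear_recurrence_tendsto_0[where \<alpha> = "1/4" and \<beta> = "1/16"])
  have "(\<lambda>n. P (Suc n) q) \<longlonglongrightarrow> 0" using assms basin_iff_P_tendsto_0 LIMSEQ_Suc by blast
  from order_tendstoD(2)[OF tendsto_norm_zero[OF this], of "1/8"]
  have "\<forall>\<^sub>F n in sequentially. cmod (P (Suc n) q) < 1/8" by simp
  then show "\<forall>\<^sub>F n in sequentially. cmod (cdot (cgrad (P (Suc (Suc n))) q) v)
      \<le> 1/4 * cmod (cdot (cgrad (P (Suc n)) q) v) + 1/16 * cmod (cdot (cgrad (P n) q) v)"
  proof eventually_elim
    case (elim n)
    have "cmod (cdot (cgrad (P (Suc (Suc n))) q) v)
        \<le> 2 * cmod (P (Suc n) q) * cmod (cdot (cgrad (P (Suc n)) q) v) + cmod (a n) * cmod (cdot (cgrad (P n) q) v)"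
      unfolding cgrad_henon_poly_Suc_Suc cdot_add_left cdot_cmul_left
      by (rule order_trans[OF norm_triangle_ineq]) (simp add: norm_mult)
    also have "\<dots> \<le> 1/4 * cmod (cdot (cgrad (P (Suc n)) q) v) + 1/16 * cmod (cdot (cgrad (P n) q) v)"
      using elim norm_a_le by (intro add_mono mult_right_mono) auto
    finally show ?case .
  qed
qed auto

lemma kobayashi_basin:
  assumes "z \<in> nonautonomous_basin F"
  shows "kobayashi (nonautonomous_basin F) z v = 0"
proof (rule kobayashi_eq_0I)
  fix r :: real assume r: "r > 0"
  define L where "L n w = (4 * cdot (cgrad (P (Suc (Suc n))) z) w, 2 * cdot (cgrad (P (Suc n)) z) w)" for n w
  have "(\<lambda>n. L n v) \<longlonglongrightarrow> 0"
    unfolding L_def zero_prod_def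
    by (intro tendsto_Pair tendsto_mult_right_zero LIMSEQ_Suc derivative_P_tendsto_0 assms)
  from order_tendstoD(2)[OF tendsto_norm_zero[OF this] r]
  have "\<forall>\<^sub>F n in sequentially. norm (L n v) < r" .
  moreover have "\<forall>\<^sub>F n in sequentially. norm (scaled_comp n z) < 1/2"
    by (rule eventually_norm_scaled_comp_less[OF assms]) simp
  ultimately obtain n where n: "norm (L n v) < r" "norm (scaled_comp n z) < 1/2"
    using eventually_happens'[OF sequentially_bot eventually_conj] by blast
  have "(scaled_comp n has_derivative L n) (at z)"
    unfolding scaled_comp_def[abs_def] L_def[abs_def]
    by (intro has_derivative_Pair has_derivative_mult_right henon_poly_has_derivative)
  moreover have "scaled_comp n -` ball 0 1 \<subseteq> nonautonomous_basin F" unfolding basin_eq_Union by blast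
  ultimately show "\<exists>H L. holomorphic_automorphism H \<and> H -` ball 0 1 \<subseteq> nonautonomous_basin F \<and>
      (H has_derivative L) (at z) \<and> norm (H z) < 1/2 \<and> norm (L v) < r"
    using n holomorphic_automorphism_scaled_comp by blast
qed

end

subsection \<open>The Green function of the basin\<close>

text \<open>The last inequality, cleared of denominators, says that the logarithmic gradient of \<open>h\<close> is almost
  twice that of \<open>g\<close>.\<close>

definition admissible_coefficient :: "(nat \<Rightarrow> complex) \<Rightarrow> nat \<Rightarrow> complex \<Rightarrow> bool" where
  "admissible_coefficient a n c \<longleftrightarrow> c \<noteq> 0 \<and> cmod c \<le> 1/16 \<and>
     (let f = henon_poly a n; g = henon_poly a (Suc n); h = (\<lambda>q. (g q)\<^sup>2 + c * f q) in
       \<forall>q. norm q \<le> real (Suc n) \<longrightarrow> cmod (c * f q) \<le> (1/8) ^ 2 ^ Suc (Suc n) / 4 \<and>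
         (2 * (1/4) ^ 2 ^ Suc n \<le> cmod (g q) \<longrightarrow>
           2 * (1 - (1/2) ^ (Suc n + 2)) * norm (cgrad g q) * cmod (h q) \<le> norm (cgrad h q) * cmod (g q)))"

locale fast_henon_sequence =
  fixes a :: "nat \<Rightarrow> complex"
  assumes admissible: "admissible_coefficient a n (a n)"

sublocale fast_henon_sequence \<subseteq> henon_sequence
  using admissible unfolding admissible_coefficient_def by unfold_locales blast+

context fast_henon_sequence
begin

lemma near_square:
  assumes "norm q \<le> real n"
  shows "cmod (P (Suc n) q - (P n q)\<^sup>2) \<le> (1/8) ^ 2 ^ Suc n / 4"
proof (cases n)
  case 0
  then show ?thesis using assms by (simp add: zero_prod_def)
next
  case (Suc k)
  have "cmod (a k * P k q) \<le> (1/8) ^ 2 ^ Suc (Suc k) / 4"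
    using admissible[of k] assms unfolding admissible_coefficient_def Let_def Suc by blast
  then show ?thesis by (simp add: Suc henon_poly.simps(3))
qed

text \<open>The floor \<open>(1/8) ^ 2 ^ n\<close> regularises the logarithm of \<open>cmod (P n q)\<close> on the zero set of \<open>P n\<close>; it is far
  below the threshold in \<open>P_large\<close>, so the perturbation is invisible where \<open>P n\<close> is large.\<close>

definition reg_modulus :: "nat \<Rightarrow> C2 \<Rightarrow> real" where
  "reg_modulus n q = cmod (P n q) + (1/8) ^ 2 ^ n"

definition P_large :: "nat \<Rightarrow> C2 \<Rightarrow> bool" where
  "P_large n q \<longleftrightarrow> 2 * (1/4) ^ 2 ^ n \<le> cmod (P n q)"

definition green_approx :: "nat \<Rightarrow> C2 \<Rightarrow> real" where
  "green_approx n q = ln (reg_modulus n q) / 2 ^ n"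

definition green :: "C2 \<Rightarrow> real" where
  "green q = lim (\<lambda>n. green_approx n q)"

lemma reg_modulus_pos: "0 < reg_modulus n q"
  by (simp add: reg_modulus_def add_nonneg_pos)

lemma reg_modulus_Suc:
  assumes "norm q \<le> real n"
  shows "reg_modulus (Suc n) q \<le> 5/4 * (reg_modulus n q)\<^sup>2"
    and "3/8 * (reg_modulus n q)\<^sup>2 \<le> reg_modulus (Suc n) q"
proof -
  define x where "x = cmod (P n q)"
  define y where "y = cmod (P (Suc n) q)"
  define \<eta> :: real where "\<eta> = (1/8) ^ 2 ^ n"
  have eta_square: "\<eta>\<^sup>2 = (1/8) ^ 2 ^ Suc n" by (simp add: \<eta>_def power_mult[symmetric] mult.commute)
  have "\<bar>y - x\<^sup>2\<bar> \<le> cmod (P (Suc n) q - (P n q)\<^sup>2)"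
    using norm_triangle_ineq3[of "P (Suc n) q" "(P n q)\<^sup>2"] by (simp add: x_def y_def norm_power)
  then have near: "\<bar>y - x\<^sup>2\<bar> \<le> \<eta>\<^sup>2 / 4" using near_square[OF assms] eta_square by simp
  have reg: "reg_modulus n q = x + \<eta>" "reg_modulus (Suc n) q = y + \<eta>\<^sup>2"
    unfolding eta_square by (simp_all add: reg_modulus_def x_def y_def \<eta>_def)
  have square: "(x + \<eta>)\<^sup>2 = x\<^sup>2 + 2 * (x * \<eta>) + \<eta>\<^sup>2" by (simp add: power2_sum)
  have "2 * (x * \<eta>) \<le> x\<^sup>2 + \<eta>\<^sup>2" using sum_squares_bound[of x \<eta>] by simp
  moreover have "0 \<le> x * \<eta>" "0 \<le> x\<^sup>2" by (simp_all add: x_def \<eta>_def)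
  ultimately show "reg_modulus (Suc n) q \<le> 5/4 * (reg_modulus n q)\<^sup>2"
    and "3/8 * (reg_modulus n q)\<^sup>2 \<le> reg_modulus (Suc n) q"
    unfolding reg square using near zero_le_power2[of \<eta>] by argo+
qed

lemma green_approx_step:
  assumes "norm q \<le> real n"
  shows "\<bar>green_approx (Suc n) q - green_approx n q\<bar> \<le> (1/2) ^ n"
proof -
  define x where "x = reg_modulus n q"
  define y where "y = reg_modulus (Suc n) q"
  have pos: "x > 0" "y > 0" by (simp_all add: x_def y_def reg_modulus_pos)
  have "ln y \<le> ln (5/4 * x\<^sup>2)" "ln (3/8 * x\<^sup>2) \<le> ln y"
    using reg_modulus_Suc[OF assms] pos by (intro ln_mono; simp add: x_def y_def)+
  moreover have "ln (c * x\<^sup>2) = ln c + 2 * ln x" if "c > 0" for c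
    using that pos by (simp add: ln_mult ln_realpow)
  from this[of "5/4"] this[of "3/8"]
  have "ln (5/4 * x\<^sup>2) = ln (5/4) + 2 * ln x" "ln (3/8 * x\<^sup>2) = ln (3/8) + 2 * ln x" by simp_all
  moreover have "ln (5/4::real) \<le> 5/4 - 1" "ln (8/3::real) \<le> 8/3 - 1" by (intro ln_le_minus_one; simp)+
  moreover have "ln (3/8::real) = - ln (8/3)" by (simp add: ln_div)
  ultimately have "\<bar>ln y - 2 * ln x\<bar> \<le> 2" by linarith
  moreover have "green_approx (Suc n) q - green_approx n q = (ln y - 2 * ln x) / 2 ^ Suc n"
    by (simp add: green_approx_def x_def y_def diff_divide_distrib)
  ultimately have "\<bar>green_approx (Suc n) q - green_approx n q\<bar> \<le> 2 / 2 ^ Suc n"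
    using divide_right_mono[of "\<bar>ln y - 2 * ln x\<bar>" 2 "2 ^ Suc n"] by (simp only: abs_divide) simp
  then show ?thesis by (simp add: power_divide)
qed

lemma green_approx_uniform_limit: "uniform_limit (cball 0 R) green_approx green sequentially"
proof -
  have "\<forall>\<^sub>F n in sequentially. R \<le> real n"
    using filterlim_real_sequentially by (simp add: filterlim_at_top)
  then have "\<forall>\<^sub>F n in sequentially. \<forall>q\<in>cball 0 R.
      norm (green_approx (Suc n) q - green_approx n q) \<le> (1/2) ^ n"
    by eventually_elim (auto intro!: green_approx_step intro: order_trans)
  then show ?thesis
    unfolding green_def[abs_def] by (rule uniform_limit_lim_if_summable_steps) simp
qed

lemma green_approx_tendsto: "(\<lambda>n. green_approx n q) \<longlonglongrightarrow> green q"
  by (rule tendsto_uniform_limitI[OF green_approx_uniform_limit[of "norm q"]]) simp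

lemma plurisubharmonic_green: "plurisubharmonic (\<lambda>q. ereal (green q)) \<Omega>"
proof (rule plurisubharmonic_uniform_limit[OF _ green_approx_uniform_limit])
  fix n
  have "continuous_on UNIV (reg_modulus n)"
    unfolding reg_modulus_def by (intro continuous_intros continuous_on_henon_poly)
  then show "continuous_on UNIV (green_approx n)"
    unfolding green_approx_def using reg_modulus_pos
    by (intro continuous_intros) (simp_all add: less_imp_neq[symmetric])
  fix p b :: C2
  have "(\<lambda>\<zeta>. P n (p + cmul \<zeta> b)) holomorphic_on S" for S
    by (rule linewise_holomorphic_on_line[OF linewise_holomorphic_on_henon_poly[OF open_UNIV]]) simp
  then have "2*pi * ln (reg_modulus n p) \<le> integral {0..2*pi} (\<lambda>\<theta>. ln (reg_modulus n (p + cmul (cis \<theta>) b)))"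
    using sub_mean_ln_norm_plus[of "\<lambda>\<zeta>. P n (p + cmul \<zeta> b)" "(1/8) ^ 2 ^ n"]
    by (simp add: reg_modulus_def holomorphic_on_imp_continuous_on)
  then have "2*pi * ln (reg_modulus n p) / 2 ^ n
      \<le> integral {0..2*pi} (\<lambda>\<theta>. ln (reg_modulus n (p + cmul (cis \<theta>) b))) / 2 ^ n"
    by (intro divide_right_mono) auto
  then show "2*pi * green_approx n p \<le> integral {0..2*pi} (\<lambda>\<theta>. green_approx n (p + cmul (cis \<theta>) b))"
    by (simp add: green_approx_def)
qed

lemma reg_modulus_iterated_squaring:
  assumes "norm q \<le> real n"
  shows "5/4 * reg_modulus (n + m) q \<le> (5/4 * reg_modulus n q) ^ 2 ^ m"
proof (induction m)
  case (Suc m)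
  have "5/4 * reg_modulus (n + Suc m) q \<le> (5/4 * reg_modulus (n + m) q)\<^sup>2"
    using reg_modulus_Suc(1)[of q "n + m"] assms by (simp add: power2_eq_square)
  also have "\<dots> \<le> ((5/4 * reg_modulus n q) ^ 2 ^ m)\<^sup>2"
    using Suc less_imp_le[OF reg_modulus_pos[of "n + m" q]] by (intro power_mono) auto
  finally show ?case by (simp add: power_mult[symmetric] mult.commute)
qed simp

lemma reg_modulus_le_iterated_square:
  assumes "norm q \<le> real n"
  shows "reg_modulus (m + n) q \<le> (5/4 * reg_modulus n q) ^ 2 ^ m"
  using reg_modulus_iterated_squaring[OF assms, of m] reg_modulus_pos[of "n + m" q]
  by (simp add: add.commute)

lemma basin_iff_reg_modulus_tendsto_0: "q \<in> nonautonomous_basin F \<longleftrightarrow> (\<lambda>n. reg_modulus n q) \<longlonglongrightarrow> 0"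
proof -
  have floor: "(\<lambda>n. (1/8::real) ^ 2 ^ n) \<longlonglongrightarrow> 0" by real_asymp
  show ?thesis
    unfolding basin_iff_P_tendsto_0
  proof
    assume "(\<lambda>n. P n q) \<longlonglongrightarrow> 0"
    from tendsto_add[OF tendsto_norm_zero[OF this] floor]
    show "(\<lambda>n. reg_modulus n q) \<longlonglongrightarrow> 0" by (simp add: reg_modulus_def)
  next
    assume "(\<lambda>n. reg_modulus n q) \<longlonglongrightarrow> 0"
    then show "(\<lambda>n. P n q) \<longlonglongrightarrow> 0"
      by (rule Lim_null_comparison[rotated]) (simp add: reg_modulus_def)
  qed
qed

lemma reg_modulus_ge_outside_basin:
  assumes "q \<notin> nonautonomous_basin F" "norm q \<le> real n"
  shows "4/5 \<le> reg_modulus n q"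
proof (rule ccontr)
  define x where "x = 5/4 * reg_modulus n q"
  assume "\<not> 4/5 \<le> reg_modulus n q"
  then have x_in_01: "0 < x" "x < 1" using reg_modulus_pos[of n q] by (auto simp: x_def)
  have "norm (reg_modulus (m + n) q) \<le> x ^ m" for m
  proof -
    have "reg_modulus (m + n) q \<le> x ^ 2 ^ m"
      unfolding x_def by (rule reg_modulus_le_iterated_square[OF assms(2)])
    also have "\<dots> \<le> x ^ m" using x_in_01 by (intro power_decreasing) (auto intro: less_imp_le)
    finally show ?thesis using reg_modulus_pos[of "m + n" q] by simp
  qed
  then have "\<forall>\<^sub>F m in sequentially. norm (reg_modulus (m + n) q) \<le> x ^ m" by simp
  moreover have "(\<lambda>m. x ^ m) \<longlonglongrightarrow> 0" using x_in_01 by (intro LIMSEQ_power_zero) simp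
  ultimately have "(\<lambda>m. reg_modulus (m + n) q) \<longlonglongrightarrow> 0" by (rule Lim_null_comparison)
  then have "(\<lambda>m. reg_modulus m q) \<longlonglongrightarrow> 0" by (rule LIMSEQ_offset)
  then show False using assms(1) basin_iff_reg_modulus_tendsto_0 by blast
qed

lemma green_neg_on_basin:
  assumes "q \<in> nonautonomous_basin F"
  shows "green q < 0"
proof -
  have "\<forall>\<^sub>F n in sequentially. norm q \<le> real n"
    using filterlim_real_sequentially by (simp add: filterlim_at_top)
  moreover have "(\<lambda>n. reg_modulus n q) \<longlonglongrightarrow> 0" using assms basin_iff_reg_modulus_tendsto_0 by blast
  then have "\<forall>\<^sub>F n in sequentially. reg_modulus n q < 4/5" by (rule order_tendstoD) simp
  ultimately obtain n where n: "norm q \<le> real n" "reg_modulus n q < 4/5"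
    using eventually_happens'[OF sequentially_bot eventually_conj] by blast
  define x where "x = 5/4 * reg_modulus n q"
  have x_in_01: "0 < x" "x < 1" using n(2) reg_modulus_pos[of n q] by (auto simp: x_def)
  have "green_approx (m + n) q \<le> ln x / 2 ^ n" for m
  proof -
    have "reg_modulus (m + n) q \<le> x ^ 2 ^ m"
      unfolding x_def by (rule reg_modulus_le_iterated_square[OF n(1)])
    then have "ln (reg_modulus (m + n) q) \<le> 2 ^ m * ln x"
      using ln_mono[of "reg_modulus (m + n) q" "x ^ 2 ^ m"] reg_modulus_pos x_in_01(1) by (simp add: ln_realpow)
    then have "green_approx (m + n) q \<le> 2 ^ m * ln x / 2 ^ (m + n)"
      unfolding green_approx_def by (intro divide_right_mono) auto
    then show ?thesis by (simp add: power_add)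
  qed
  then have "green q \<le> ln x / 2 ^ n"
    by (intro LIMSEQ_le_const2[OF LIMSEQ_ignore_initial_segment[OF green_approx_tendsto]]) auto
  also have "\<dots> < 0" using x_in_01 by (simp add: divide_neg_pos)
  finally show ?thesis .
qed

lemma green_nonneg_outside_basin:
  assumes "q \<notin> nonautonomous_basin F"
  shows "0 \<le> green q"
proof (rule LIMSEQ_le)
  show "(\<lambda>n. ln (4/5) / 2 ^ n :: real) \<longlonglongrightarrow> 0" by real_asymp
  obtain N :: nat where N: "norm q \<le> real N" using real_arch_simple by blast
  have "ln (4/5) / 2 ^ n \<le> green_approx n q" if "n \<ge> N" for n
    unfolding green_approx_def
    by (intro divide_right_mono ln_mono reg_modulus_ge_outside_basin[OF assms])
      (use N that in \<open>auto intro: order_trans\<close>)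
  then show "\<exists>N. \<forall>n\<ge>N. ln (4/5) / 2 ^ n \<le> green_approx n q" by blast
qed (rule green_approx_tendsto)

lemma basin_iff_green_neg: "q \<in> nonautonomous_basin F \<longleftrightarrow> green q < 0"
  using green_neg_on_basin green_nonneg_outside_basin linorder_not_le by blast

lemma P_large_Suc:
  assumes "norm q \<le> real n" "P_large n q"
  shows "P_large (Suc n) q" and "cmod (P (Suc n) q / (P n q)\<^sup>2 - 1) \<le> 1/16"
proof -
  define s :: real where "s = (1/4) ^ 2 ^ n"
  have s_props: "s > 0" "(1/4) ^ 2 ^ Suc n = s\<^sup>2" by (simp_all add: s_def power_mult[symmetric] mult.commute)
  have "(2 * s)\<^sup>2 \<le> (cmod (P n q))\<^sup>2"
    using assms(2) s_props(1) by (intro power_mono) (simp_all add: P_large_def s_def)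
  then have square: "4 * s\<^sup>2 \<le> cmod ((P n q)\<^sup>2)" by (simp add: norm_power power_mult_distrib)
  have "(1/8::real) ^ 2 ^ Suc n \<le> (1/4) ^ 2 ^ Suc n" by (rule power_mono) auto
  then have near: "cmod (P (Suc n) q - (P n q)\<^sup>2) \<le> s\<^sup>2 / 4"
    using near_square[OF assms(1)] unfolding s_props(2) by linarith
  have "cmod ((P n q)\<^sup>2) \<le> cmod (P (Suc n) q) + cmod (P (Suc n) q - (P n q)\<^sup>2)"
    by (metis norm_minus_commute norm_triangle_sub)
  then have "2 * s\<^sup>2 \<le> cmod (P (Suc n) q)" using square near zero_le_power2[of s] by linarith
  then show "P_large (Suc n) q" unfolding P_large_def s_props(2) .
  have "0 < 4 * s\<^sup>2" using s_props(1) by simp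
  then have pos: "0 < cmod ((P n q)\<^sup>2)" using square by (rule less_le_trans)
  then have "P (Suc n) q / (P n q)\<^sup>2 - 1 = (P (Suc n) q - (P n q)\<^sup>2) / (P n q)\<^sup>2" by (simp add: field_simps)
  then have "cmod (P (Suc n) q / (P n q)\<^sup>2 - 1) = cmod (P (Suc n) q - (P n q)\<^sup>2) / cmod ((P n q)\<^sup>2)"
    by (simp only: norm_divide)
  also have "\<dots> \<le> 1/16" using pos near square by (simp add: divide_le_eq)
  finally show "cmod (P (Suc n) q / (P n q)\<^sup>2 - 1) \<le> 1/16" .
qed

lemma P_large_add:
  assumes "norm q \<le> real n" "P_large n q"
  shows "P_large (n + m) q"
proof (induction m)
  case (Suc m)
  then show ?case using P_large_Suc(1)[of q "n + m"] assms(1) by simp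
qed (use assms(2) in simp)

lemma P_large_imp_nonzero:
  assumes "P_large n q"
  shows "P n q \<noteq> 0"
proof -
  have "0 < 2 * (1/4::real) ^ 2 ^ n" by simp
  also have "\<dots> \<le> cmod (P n q)" using assms by (simp add: P_large_def)
  finally show ?thesis by simp
qed

lemma ln_P_tendsto_green:
  assumes "norm q \<le> real n" "P_large n q"
  shows "(\<lambda>m. ln (cmod (P (n + m) q)) / 2 ^ (n + m)) \<longlonglongrightarrow> green q"
proof -
  have close: "\<bar>ln (cmod (P (n + m) q)) / 2 ^ (n + m) - green_approx (n + m) q\<bar> \<le> 1 / 2 ^ (n + m)" for m
  proof -
    define k where "k = n + m"
    have "(1/8::real) ^ 2 ^ k \<le> (1/4) ^ 2 ^ k" by (rule power_mono) auto
    moreover have "0 < (1/4::real) ^ 2 ^ k" by simp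
    ultimately have floor: "(1/8) ^ 2 ^ k \<le> cmod (P k q)"
      using P_large_add[OF assms, of m] unfolding P_large_def k_def by linarith
    have pos: "0 < cmod (P k q)" using P_large_imp_nonzero[OF P_large_add[OF assms]] by (simp add: k_def)
    have "ln (reg_modulus k q) - ln (cmod (P k q)) \<le> (reg_modulus k q - cmod (P k q)) / cmod (P k q)"
      by (intro ln_diff_le reg_modulus_pos pos)
    also have "\<dots> \<le> 1" using floor pos by (simp add: reg_modulus_def divide_le_eq)
    finally have "ln (reg_modulus k q) - ln (cmod (P k q)) \<le> 1" .
    moreover have "ln (cmod (P k q)) \<le> ln (reg_modulus k q)"
      using pos by (intro ln_mono) (simp_all add: reg_modulus_def)
    ultimately have "\<bar>ln (cmod (P k q)) - ln (reg_modulus k q)\<bar> / 2 ^ k \<le> 1 / 2 ^ k"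
      by (intro divide_right_mono) auto
    then show ?thesis by (simp add: green_approx_def k_def diff_divide_distrib[symmetric])
  qed
  have "(\<lambda>m. 1 / 2 ^ (n + m) :: real) \<longlonglongrightarrow> 0" by real_asymp
  then have "(\<lambda>m. ln (cmod (P (n + m) q)) / 2 ^ (n + m) - green_approx (n + m) q) \<longlonglongrightarrow> 0"
    by (rule Lim_null_comparison[rotated]) (use close in simp)
  moreover have "(\<lambda>m. green_approx (n + m) q) \<longlonglongrightarrow> green q"
    using LIMSEQ_ignore_initial_segment[OF green_approx_tendsto, of n] by (simp add: add.commute)
  ultimately show ?thesis by (rule Lim_transform[rotated])
qed

lemma green_ge_if_P_large:
  assumes "norm q \<le> real n" "P_large n q"
  shows "ln (1/4) \<le> green q"
proof -
  have "ln (1/4) \<le> ln (cmod (P (n + m) q)) / 2 ^ (n + m)" for m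
  proof -
    have "(1/4) ^ 2 ^ (n + m) \<le> cmod (P (n + m) q)"
      using P_large_add[OF assms, of m] zero_le_power[of "1/4::real" "2 ^ (n + m)"]
      unfolding P_large_def by linarith
    then have "ln ((1/4) ^ 2 ^ (n + m)) \<le> ln (cmod (P (n + m) q))" by (intro ln_mono) auto
    moreover have "ln ((1/4::real) ^ 2 ^ (n + m)) = 2 ^ (n + m) * ln (1/4)" by (subst ln_realpow) simp_all
    ultimately show ?thesis by (simp add: pos_le_divide_eq mult.commute)
  qed
  then show ?thesis by (intro LIMSEQ_le_const[OF ln_P_tendsto_green[OF assms]]) auto
qed

lemma green_at_0: "green 0 = ln (1/8)"
proof -
  have "green_approx n 0 = ln (1/8)" for n
    by (simp add: green_approx_def reg_modulus_def henon_poly_at_0 ln_realpow)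
  then show ?thesis using green_approx_tendsto[of 0] by (simp add: LIMSEQ_const_iff)
qed

lemma green_nonconstant: "green (1/8, 0) \<noteq> green 0"
proof -
  have "norm (1/8 :: complex, 0 :: complex) = 1/8" by (simp add: norm_prod_def norm_divide)
  then have "ln (1/4) \<le> green (1/8, 0)"
    by (intro green_ge_if_P_large[of _ 1]) (simp_all add: P_large_def power2_eq_square norm_divide)
  moreover have "ln (1/8::real) < ln (1/4)" by simp
  ultimately show ?thesis unfolding green_at_0 by linarith
qed

lemma eighth_in_basin: "(1/8, 0) \<in> nonautonomous_basin F"
proof -
  have "scaled_comp 0 (1/8, 0) = (1/16, 1/4)"
    by (simp add: scaled_comp_def henon_poly.simps(3) power2_eq_square)
  moreover have "norm (1/16 :: complex, 1/4 :: complex) < 1"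
    by (simp add: norm_prod_def power2_eq_square norm_divide real_less_lsqrt)
  ultimately have "(1/8, 0) \<in> scaled_comp 0 -` ball 0 1" by simp
  then show ?thesis unfolding basin_eq_Union by blast
qed

theorem short_C2_basin: "short_C2 (nonautonomous_basin F)"
  unfolding short_C2_def
proof (intro conjI)
  have "0 \<in> nonautonomous_basin F" unfolding basin_iff_P_tendsto_0 by (simp add: henon_poly_at_0)
  then have "\<exists>z\<in>nonautonomous_basin F. \<exists>w\<in>nonautonomous_basin F. ereal (green z) \<noteq> ereal (green w)"
    using eighth_in_basin green_nonconstant by (intro bexI[of _ "(1/8, 0)"] bexI[of _ 0]) simp_all
  moreover have "\<forall>z\<in>nonautonomous_basin F. ereal (green z) \<le> ereal 0"
    using green_neg_on_basin by (auto intro: less_imp_le)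
  ultimately show "\<exists>u. plurisubharmonic u (nonautonomous_basin F) \<and>
      (\<exists>M::real. \<forall>z\<in>nonautonomous_basin F. u z \<le> ereal M) \<and>
      (\<exists>z\<in>nonautonomous_basin F. \<exists>w\<in>nonautonomous_basin F. u z \<noteq> u w)"
    using plurisubharmonic_green by blast
qed (use open_basin connected_basin basin_increasing_union_of_balls kobayashi_basin in blast)+

end

subsection \<open>The boundary of the basin\<close>

context fast_henon_sequence
begin

text \<open>The norm of the gradient of \<open>ln (cmod (P n q)) / 2 ^ n\<close>.\<close>

definition log_gradient :: "nat \<Rightarrow> C2 \<Rightarrow> real" where
  "log_gradient n q = norm (cgrad (P n) q) / (2 ^ n * cmod (P n q))"

lemma log_gradient_pos:
  assumes "P_large n q"
  shows "0 < log_gradient n q"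
  using cgrad_henon_poly_nonzero(1)[of n a q] a_nonzero P_large_imp_nonzero[OF assms]
  by (simp add: log_gradient_def)

lemma log_gradient_Suc:
  assumes "norm q \<le> real n" "P_large n q"
  shows "(1 - (1/2) ^ (n + 2)) * log_gradient n q \<le> log_gradient (Suc n) q"
proof (cases n)
  case 0
  then have "q = 0" using assms(1) by simp
  then show ?thesis using P_large_imp_nonzero[OF assms(2)] by (simp add: henon_poly_at_0)
next
  case (Suc k)
  define c :: real where "c = 1 - (1/2) ^ (n + 2)"
  have "2 * c * norm (cgrad (P n) q) * cmod (P (Suc n) q) \<le> norm (cgrad (P (Suc n)) q) * cmod (P n q)"
    using admissible[of k] assms
    unfolding admissible_coefficient_def Let_def P_large_def c_def Suc henon_poly.simps(3)[of a k] by blast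
  moreover have "0 < cmod (P n q)" "0 < cmod (P (Suc n) q)"
    using P_large_imp_nonzero P_large_Suc(1) assms by auto
  ultimately have "c * (norm (cgrad (P n) q) / cmod (P n q))
      \<le> norm (cgrad (P (Suc n)) q) / (2 * cmod (P (Suc n) q))"
    by (simp add: field_simps)
  from divide_right_mono[OF this, of "2 ^ n"] show ?thesis
    by (simp add: log_gradient_def c_def mult_ac)
qed

lemma log_gradient_lower_bound:
  assumes "norm q \<le> real n" "P_large n q"
  shows "log_gradient n q * ((1 + (1/2) ^ m) / 2) \<le> log_gradient (n + m) q"
proof (induction m)
  case (Suc m)
  define x :: real where "x = (1/2) ^ m"
  have x_in_01: "0 < x" "x \<le> 1" by (simp_all add: x_def power_le_one)
  have "x * x \<le> x" using x_in_01 by (simp add: mult_left_le)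
  moreover have "(1 - x / 4) * ((1 + x) / 2) = (1 + x / 2) / 2 + (x - x * x) / 8" by (simp add: field_simps)
  ultimately have "(1 + (1/2) ^ Suc m) / 2 \<le> (1 - x / 4) * ((1 + x) / 2)" by (simp add: x_def)
  then have "log_gradient n q * ((1 + (1/2) ^ Suc m) / 2) \<le> log_gradient n q * ((1 - x / 4) * ((1 + x) / 2))"
    using log_gradient_pos[OF assms(2)] by (intro mult_left_mono) auto
  also have "\<dots> = (1 - x / 4) * (log_gradient n q * ((1 + x) / 2))" by simp
  also have "\<dots> \<le> (1 - x / 4) * log_gradient (n + m) q"
    using Suc x_in_01 by (intro mult_left_mono) (auto simp: x_def)
  also have "\<dots> \<le> (1 - (1/2) ^ (n + m + 2)) * log_gradient (n + m) q"
  proof (rule mult_right_mono)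
    have "(1/2::real) ^ (n + m + 2) \<le> (1/2) ^ (m + 2)" by (rule power_decreasing) auto
    then show "1 - x / 4 \<le> 1 - (1/2) ^ (n + m + 2)" by (simp add: x_def power_add power2_eq_square)
  qed (simp add: log_gradient_def)
  also have "\<dots> \<le> log_gradient (n + Suc m) q"
    using log_gradient_Suc[OF _ P_large_add[OF assms], of m] assms(1) by simp
  finally show ?case .
qed simp

end

lemma Re_pos_if_near_1: "cmod (z - 1) < 1 \<Longrightarrow> 0 < Re z"
  using abs_Re_le_cmod[of "z - 1"] by auto

text \<open>On a chart all \<open>P (N + m)\<close> have holomorphic logarithms: \<open>P N\<close> takes values in a disc around \<open>w\<close> not
  containing \<open>0\<close>, and the quotients \<open>P (n + 1) / (P n)\<^sup>2\<close> are close to \<open>1\<close>.\<close>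

locale log_chart = fast_henon_sequence a for a :: "nat \<Rightarrow> complex" +
  fixes N :: nat and W :: "C2 set" and w :: complex
  assumes open_W: "open W"
    and W_norm: "q \<in> W \<Longrightarrow> norm q \<le> real N"
    and W_large: "q \<in> W \<Longrightarrow> P_large N q"
    and W_near: "q \<in> W \<Longrightarrow> cmod (P N q - w) < cmod w"
begin

definition square_ratio :: "nat \<Rightarrow> C2 \<Rightarrow> complex" where
  "square_ratio m q = P (Suc (N + m)) q / (P (N + m) q)\<^sup>2"

definition log_branch :: "nat \<Rightarrow> C2 \<Rightarrow> complex" where
  "log_branch m q = (Ln (P N q / w) + Ln w) / 2 ^ N + (\<Sum>j<m. Ln (square_ratio j q) / 2 ^ Suc (N + j))"

definition log_limit :: "C2 \<Rightarrow> complex" where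
  "log_limit q = lim (\<lambda>m. log_branch m q)"

lemma P_nonzero: "q \<in> W \<Longrightarrow> P (N + m) q \<noteq> 0"
  using P_large_imp_nonzero P_large_add W_norm W_large by blast

lemma square_ratio_near_1: "q \<in> W \<Longrightarrow> cmod (square_ratio m q - 1) \<le> 1/16"
  unfolding square_ratio_def using W_norm[of q] P_large_add[OF W_norm W_large]
  by (intro P_large_Suc(2)) auto

lemma Re_square_ratio_pos: "q \<in> W \<Longrightarrow> 0 < Re (square_ratio m q)"
  using square_ratio_near_1[of q m] by (intro Re_pos_if_near_1) simp

lemma Re_P_quotient_pos:
  assumes "q \<in> W"
  shows "0 < Re (P N q / w)"
proof (rule Re_pos_if_near_1)
  have "w \<noteq> 0" using W_near[OF assms] by auto
  then have "P N q / w - 1 = (P N q - w) / w" by (simp add: field_simps)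
  then show "cmod (P N q / w - 1) < 1"
    using W_near[OF assms] \<open>w \<noteq> 0\<close> by (simp only: norm_divide) (simp add: divide_less_eq)
qed

lemma log_branch_Suc: "log_branch (Suc m) q = log_branch m q + Ln (square_ratio m q) / 2 ^ Suc (N + m)"
  by (simp add: log_branch_def)

lemma exp_log_branch:
  assumes q: "q \<in> W"
  shows "exp (2 ^ (N + m) * log_branch m q) = P (N + m) q"
proof (induction m)
  case 0
  have "w \<noteq> 0" using W_near[OF q] by auto
  then show ?case using P_nonzero[OF q, of 0] by (simp add: log_branch_def exp_add)
next
  case (Suc m)
  have "square_ratio m q \<noteq> 0" using Re_square_ratio_pos[OF q, of m] by auto
  have "2 ^ (N + Suc m) * log_branch (Suc m) q = of_nat 2 * (2 ^ (N + m) * log_branch m q) + Ln (square_ratio m q)"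
    unfolding log_branch_Suc by (simp add: field_simps)
  then have "exp (2 ^ (N + Suc m) * log_branch (Suc m) q)
      = exp (2 ^ (N + m) * log_branch m q) ^ 2 * exp (Ln (square_ratio m q))"
    by (simp only: exp_add exp_of_nat_mult)
  also have "\<dots> = (P (N + m) q)\<^sup>2 * square_ratio m q"
    using Suc \<open>square_ratio m q \<noteq> 0\<close> by simp
  also have "\<dots> = P (N + Suc m) q" using P_nonzero[OF q, of m] by (simp add: square_ratio_def)
  finally show ?case .
qed

lemma Re_log_branch:
  assumes "q \<in> W"
  shows "Re (log_branch m q) = ln (cmod (P (N + m) q)) / 2 ^ (N + m)"
proof -
  have "cmod (P (N + m) q) = exp (2 ^ (N + m) * Re (log_branch m q))"
    unfolding exp_log_branch[OF assms, symmetric] by (simp del: of_real_power add: norm_exp_eq_Re Re_power_real)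
  then show ?thesis by simp
qed

lemma linewise_holomorphic_on_square_ratio: "linewise_holomorphic_on (square_ratio m) W"
proof -
  have "linewise_holomorphic_on (\<lambda>q. P (Suc (N + m)) q * inverse (P (N + m) q * P (N + m) q)) W"
    using P_nonzero by (intro linewise_holomorphic_on_mult linewise_holomorphic_on_inverse
        linewise_holomorphic_on_henon_poly open_W) simp
  then show ?thesis unfolding square_ratio_def[abs_def] by (simp add: divide_inverse power2_eq_square)
qed

lemma linewise_holomorphic_on_log_branch: "linewise_holomorphic_on (log_branch m) W"
proof (induction m)
  case 0
  have "linewise_holomorphic_on (\<lambda>q. Ln (P N q * (1 / w))) W"
    using Re_P_quotient_pos
    by (intro linewise_holomorphic_on_Ln linewise_holomorphic_on_mult linewise_holomorphic_on_henon_poly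
        linewise_holomorphic_on_const open_W) simp
  then have "linewise_holomorphic_on (\<lambda>q. (Ln (P N q * (1 / w)) + Ln w) * (1 / 2 ^ N)) W"
    by (intro linewise_holomorphic_on_mult linewise_holomorphic_on_add linewise_holomorphic_on_const open_W)
  then show ?case unfolding log_branch_def[abs_def] by simp
next
  case (Suc m)
  have "linewise_holomorphic_on (\<lambda>q. log_branch m q + Ln (square_ratio m q) * (1 / 2 ^ Suc (N + m))) W"
    by (intro linewise_holomorphic_on_add linewise_holomorphic_on_mult Suc linewise_holomorphic_on_Ln
        linewise_holomorphic_on_square_ratio Re_square_ratio_pos linewise_holomorphic_on_const open_W)
  then show ?case unfolding log_branch_Suc[abs_def] by simp
qed

lemma log_branch_uniform_limit: "uniform_limit W log_branch log_limit sequentially"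
proof -
  have "norm (log_branch (Suc m) q - log_branch m q) \<le> (1/2) ^ m" if "q \<in> W" for m q
  proof -
    have "norm (log_branch (Suc m) q - log_branch m q) = cmod (Ln (square_ratio m q)) / 2 ^ Suc (N + m)"
      by (simp add: log_branch_Suc norm_divide norm_mult norm_power)
    also have "\<dots> \<le> 1 / 2 ^ m"
    proof (intro frac_le power_increasing)
      show "cmod (Ln (square_ratio m q)) \<le> 1"
        using norm_Ln_le[of "square_ratio m q - 1"] square_ratio_near_1[OF that, of m] by simp
    qed auto
    finally show ?thesis by (simp add: power_divide)
  qed
  then show ?thesis
    unfolding log_limit_def[abs_def]
    by (intro uniform_limit_lim_if_summable_steps always_eventually) (auto intro: summable_geometric)
qed

lemma linewise_holomorphic_on_log_limit: "linewise_holomorphic_on log_limit W"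
  by (rule linewise_holomorphic_on_uniform_limit[OF linewise_holomorphic_on_log_branch log_branch_uniform_limit])

lemma Re_log_limit:
  assumes "q \<in> W"
  shows "Re (log_limit q) = green q"
proof (rule LIMSEQ_unique)
  show "(\<lambda>m. Re (log_branch m q)) \<longlonglongrightarrow> Re (log_limit q)"
    by (intro tendsto_Re tendsto_uniform_limitI[OF log_branch_uniform_limit assms])
  show "(\<lambda>m. Re (log_branch m q)) \<longlonglongrightarrow> green q"
    unfolding Re_log_branch[OF assms] by (rule ln_P_tendsto_green[OF W_norm W_large]) (rule assms)+
qed

lemma norm_cgrad_log_branch:
  assumes q: "q \<in> W"
  shows "norm (cgrad (log_branch m) q) = log_gradient (N + m) q"
proof -
  have "cgrad (P (N + m)) q = cmul (2 ^ (N + m) * P (N + m) q) (cgrad (log_branch m) q)"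
    by (rule cgrad_eq_if_exp_eq[OF linewise_holomorphic_on_log_branch exp_log_branch q])
  then show ?thesis
    using P_nonzero[OF q, of m] by (simp add: log_gradient_def norm_cmul norm_mult norm_power)
qed

lemma cgrad_log_limit_nonzero:
  assumes q: "q \<in> W"
  shows "cgrad log_limit q \<noteq> 0"
proof -
  have "(\<lambda>m. norm (cgrad (log_branch m) q)) \<longlonglongrightarrow> norm (cgrad log_limit q)"
    by (intro tendsto_norm cgrad_uniform_limit[OF linewise_holomorphic_on_log_branch log_branch_uniform_limit q])
  moreover have "log_gradient N q / 2 \<le> norm (cgrad (log_branch m) q)" for m
  proof -
    have "log_gradient N q * (1 / 2) \<le> log_gradient N q * ((1 + (1/2) ^ m) / 2)"
      using log_gradient_pos[OF W_large[OF q]] by (intro mult_left_mono) auto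
    also have "\<dots> \<le> norm (cgrad (log_branch m) q)"
      unfolding norm_cgrad_log_branch[OF q] by (rule log_gradient_lower_bound[OF W_norm[OF q] W_large[OF q]])
    finally show ?thesis by simp
  qed
  ultimately have "log_gradient N q / 2 \<le> norm (cgrad log_limit q)" by (intro LIMSEQ_le_const) auto
  then show ?thesis using log_gradient_pos[OF W_large[OF q]] by auto
qed

end

context fast_henon_sequence
begin

lemma exists_log_chart:
  assumes "p \<notin> nonautonomous_basin F"
  obtains N W where "p \<in> W" "log_chart a N W (P N p)"
proof -
  obtain N :: nat where N: "norm p + 1 \<le> real N" using real_arch_simple by blast
  then have "N \<ge> 1" using norm_ge_zero[of p] by linarith
  then have "(1/8::real) ^ 2 ^ N \<le> (1/8) ^ 1" "(1/4::real) ^ 2 ^ N \<le> (1/4) ^ 2"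
    using self_le_power[of 2 N] by (intro power_decreasing; simp)+
  then have floor: "(1/8::real) ^ 2 ^ N \<le> 1/8" "2 * (1/4::real) ^ 2 ^ N \<le> 1/8"
    by (simp_all add: power2_eq_square)
  moreover have "4/5 \<le> reg_modulus N p" by (rule reg_modulus_ge_outside_basin[OF assms]) (use N in simp)
  ultimately have p: "1/2 < cmod (P N p)" by (simp add: reg_modulus_def)
  define W where "W = ball p 1 \<inter> P N -` ball (P N p) (cmod (P N p) - 1/2)"
  have near: "cmod (P N q - P N p) < cmod (P N p) - 1/2" if "q \<in> W" for q
    using that by (simp add: W_def dist_norm norm_minus_commute)
  have "log_chart a N W (P N p)"
  proof unfold_locales
    show "open W"
      unfolding W_def by (intro open_Int open_ball open_vimage continuous_on_henon_poly)
    fix q assume q: "q \<in> W"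
    then show "norm q \<le> real N"
      using N norm_triangle_sub[of q p] by (simp add: W_def dist_norm norm_minus_commute)
    show "cmod (P N q - P N p) < cmod (P N p)" using near[OF q] by simp
    have "1/2 \<le> cmod (P N q)"
      using near[OF q] norm_triangle_sub[of "P N p" "P N q"] by (simp add: norm_minus_commute)
    then show "P_large N q" using floor(2) by (simp add: P_large_def)
  qed
  moreover have "p \<in> W" using p by (simp add: W_def)
  ultimately show ?thesis using that by blast
qed

theorem smooth_boundary_basin: "smooth_boundary (nonautonomous_basin F)"
proof (rule smooth_boundary_if_locally_pluriharmonic)
  fix p assume "p \<in> frontier (nonautonomous_basin F)"
  then have "p \<notin> nonautonomous_basin F" using open_basin by (simp add: frontier_def interior_open)
  then obtain N W where p: "p \<in> W" and chart: "log_chart a N W (P N p)" by (rule exists_log_chart)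
  interpret log_chart a N W "P N p" by (rule chart)
  show "\<exists>W f. p \<in> W \<and> linewise_holomorphic_on f W \<and>
      nonautonomous_basin F \<inter> W = {q\<in>W. Re (f q) < 0} \<and> (\<forall>q\<in>W. cgrad f q \<noteq> 0)"
  proof (intro exI conjI)
    show "linewise_holomorphic_on log_limit W" by (rule linewise_holomorphic_on_log_limit)
    show "nonautonomous_basin F \<inter> W = {q\<in>W. Re (log_limit q) < 0}"
      using basin_iff_green_neg Re_log_limit by fastforce
  qed (use p cgrad_log_limit_nonzero in blast)+
qed

end

subsection \<open>Choice of the coefficients\<close>

text \<open>At \<open>c = 0\<close> the inequality is strict, because then \<open>(g q)\<^sup>2\<close> has exactly twice the logarithmic gradient
  of \<open>g\<close>; compactness yields uniformity in \<open>q\<close>.\<close>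

lemma eventually_log_gradient_almost_doubles:
  fixes f g :: "C2 \<Rightarrow> complex" and Df Dg :: "C2 \<Rightarrow> C2"
  assumes cont: "continuous_on UNIV f" "continuous_on UNIV g" "continuous_on UNIV Df" "continuous_on UNIV Dg"
    and nonzero: "\<And>q. Dg q \<noteq> 0" and "t > 0" "\<tau> > 0" and "compact K"
  shows "\<forall>\<^sub>F c in nhds 0. \<forall>q\<in>K. t \<le> cmod (g q) \<longrightarrow>
     2 * (1 - \<tau>) * norm (Dg q) * cmod ((g q)\<^sup>2 + c * f q)
       \<le> norm (cmul (2 * g q) (Dg q) + cmul c (Df q)) * cmod (g q)"
proof -
  define u where "u p = 2 * (1 - \<tau>) * norm (Dg (snd p)) * cmod ((g (snd p))\<^sup>2 + fst p * f (snd p))"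
    for p :: "complex \<times> C2"
  define v where "v p = norm (cmul (2 * g (snd p)) (Dg (snd p)) + cmul (fst p) (Df (snd p))) * cmod (g (snd p))"
    for p :: "complex \<times> C2"
  have continuous_on_snd_comp: "continuous_on UNIV (\<lambda>p :: complex \<times> C2. h (snd p))" if "continuous_on UNIV h"
    for h :: "C2 \<Rightarrow> 'a::topological_space"
    by (rule continuous_on_compose2[OF that]) (auto intro!: continuous_intros)
  have "\<forall>\<^sub>F c in nhds 0. \<forall>q \<in> K \<inter> {q. t \<le> cmod (g q)}. u (c, q) < v (c, q)"
  proof (rule eventually_less_on_compact)
    show "compact (K \<inter> {q. t \<le> cmod (g q)})"
      using cont(2) by (intro compact_Int_closed \<open>compact K\<close> closed_Collect_le continuous_intros)
    show "continuous_on UNIV u" "continuous_on UNIV v"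
      unfolding u_def v_def by (intro continuous_intros continuous_on_snd_comp cont)+
    show "u (0, q) < v (0, q)" if "q \<in> K \<inter> {q. t \<le> cmod (g q)}" for q
    proof -
      have "0 < cmod (g q)" using that \<open>t > 0\<close> by (auto intro: less_le_trans)
      then have "0 < norm (Dg q) * (cmod (g q))\<^sup>2" using nonzero[of q] by simp
      from mult_strict_right_mono[OF _ this, of "1 - \<tau>" 1]
      have "(1 - \<tau>) * (norm (Dg q) * (cmod (g q))\<^sup>2) < norm (Dg q) * (cmod (g q))\<^sup>2"
        using \<open>\<tau> > 0\<close> by simp
      moreover have "u (0, q) = 2 * ((1 - \<tau>) * (norm (Dg q) * (cmod (g q))\<^sup>2))"
        by (simp add: u_def norm_power)
      moreover have "v (0, q) = 2 * (norm (Dg q) * (cmod (g q))\<^sup>2)"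
        by (simp add: v_def norm_cmul norm_mult power2_eq_square)
      ultimately show ?thesis by linarith
    qed
  qed
  then show ?thesis by eventually_elim (auto simp: u_def v_def intro: less_imp_le)
qed

lemma exists_admissible_coefficient:
  assumes "\<And>i. i < n \<Longrightarrow> a i \<noteq> 0"
  shows "\<exists>c. admissible_coefficient a n c"
proof -
  define f where "f = henon_poly a n"
  define g where "g = henon_poly a (Suc n)"
  define K where "K = cball (0::C2) (real (Suc n))"
  have cgrad_next: "cgrad (\<lambda>q. (g q)\<^sup>2 + c * f q) q = cmul (2 * g q) (cgrad g q) + cmul c (cgrad f q)" for c q
    unfolding f_def g_def by (rule cgrad_square_plus[OF henon_poly_has_derivative henon_poly_has_derivative])
  have "\<forall>\<^sub>F c in nhds 0. \<forall>q\<in>K. cmod (fst (c, q) * f (snd (c, q))) < (1/8) ^ 2 ^ Suc (Suc n) / 4"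
    by (rule eventually_less_on_compact)
      (auto simp: K_def f_def intro!: continuous_intros continuous_on_compose2[OF continuous_on_henon_poly])
  moreover have "\<forall>\<^sub>F c in nhds 0. \<forall>q\<in>K. 2 * (1/4) ^ 2 ^ Suc n \<le> cmod (g q) \<longrightarrow>
      2 * (1 - (1/2) ^ (Suc n + 2)) * norm (cgrad g q) * cmod ((g q)\<^sup>2 + c * f q)
        \<le> norm (cmul (2 * g q) (cgrad g q) + cmul c (cgrad f q)) * cmod (g q)"
    using cgrad_henon_poly_nonzero(2)[OF assms] unfolding f_def g_def K_def
    by (intro eventually_log_gradient_almost_doubles continuous_on_henon_poly continuous_on_cgrad_henon_poly) auto
  moreover have "\<forall>\<^sub>F c::complex in nhds 0. cmod c < 1/16"
    unfolding eventually_nhds_metric by (intro exI[of _ "1/16"]) (simp add: dist_norm)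
  ultimately have "\<forall>\<^sub>F c in nhds 0. c \<noteq> 0 \<longrightarrow> admissible_coefficient a n c"
  proof eventually_elim
    case (elim c)
    then show ?case
      unfolding admissible_coefficient_def Let_def f_def[symmetric] g_def[symmetric] cgrad_next
      by (auto simp: K_def intro: less_imp_le)
  qed
  then have "\<forall>\<^sub>F c in at 0. admissible_coefficient a n c" by (simp add: eventually_at_filter)
  then show ?thesis by (rule eventually_happens'[OF at_neq_bot])
qed

lemma admissible_coefficient_cong:
  assumes "\<And>i. i < n \<Longrightarrow> a i = b i"
  shows "admissible_coefficient a n = admissible_coefficient b n"
proof -
  have "henon_poly a n = henon_poly b n" "henon_poly a (Suc n) = henon_poly b (Suc n)"
    using assms by (auto intro!: henon_poly_cong)
  then show ?thesis unfolding admissible_coefficient_def[abs_def] by simp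
qed

lemma fast_henon_sequence_exists: "\<exists>a. fast_henon_sequence a"
proof -
  have "\<exists>a. \<forall>n. admissible_coefficient a n (a n)"
  proof (rule dependent_wellorder_choice)
    show "admissible_coefficient a n c = admissible_coefficient b n c" if "\<And>i. i < n \<Longrightarrow> a i = b i" for a b n c
      using admissible_coefficient_cong[of n a b] that by simp
    show "\<exists>c. admissible_coefficient a n c" if "\<And>i. i < n \<Longrightarrow> admissible_coefficient a i (a i)" for a n
      using that by (intro exists_admissible_coefficient) (auto simp: admissible_coefficient_def)
  qed
  then show ?thesis by (auto simp: fast_henon_sequence_def)
qed

theorem theorem1p5:
  shows "\<exists>F :: nat \<Rightarrow> C2 \<Rightarrow> C2.
           (\<forall>n. holomorphic_automorphism (F n) \<and> attracting_fixed_point_at_0 (F n)) \<and>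
           short_C2 (nonautonomous_basin F) \<and> smooth_boundary (nonautonomous_basin F)"
proof -
  obtain a where "fast_henon_sequence a" using fast_henon_sequence_exists by blast
  then interpret fast_henon_sequence a .
  show ?thesis
    using holomorphic_automorphism_F attracting_fixed_point_at_0_F short_C2_basin smooth_boundary_basin by blast
qed

end
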